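(* Let $\Gamma=(X,E)$ be a finite connected simple graph and let $x_0\in X$ be a vertex of valency one, with unique neighbour $x_1$. Set $X'=X\setminus\{x_0\}$, $E'=E\setminus\{\{x_0,x_1\}\}$ and $\Gamma'=(X',E')$. Let $\ell\in\{2,3\}$ and suppose that $\mathcal{T}_\ell(\Gamma',x_1)\cong M_{n_0}(\mathbb{C})\oplus\bigoplus_{i=1}^r M_{n_i}(\mathbb{C})$ as $\mathbb{C}$-algebras, where the primitive idempotent $E_{x_1}$ belongs to the summand $M_{n_0}(\mathbb{C})$. Then $\mathcal{T}_\ell(\Gamma,x_0)\cong M_{n_0+1}(\mathbb{C})\oplus\bigoplus_{i=1}^r M_{n_i}(\mathbb{C})$, and the primitive idempotent $E_{x_0}$ belongs to the summand $M_{n_0+1}(\mathbb{C})$.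
   Context: For a finite connected simple graph $\Gamma=(X,E)$ with adjacency matrix $A$ and base vertex $x_0\in X$, let $M_X(\mathbb{C})$ be the algebra of complex matrices with rows and columns indexed by $X$. For $Y\subset X$, $E_Y\in M_X(\mathbb{C})$ is the diagonal matrix with $(x,x)$-entry $1$ if $x\in Y$ and $0$ otherwise; $E_x=E_{\{x\}}$. $\mathbb{C}\langle S\rangle$ denotes the unital $\mathbb{C}$-subalgebra of $M_X(\mathbb{C})$ generated by $S$. Let $X_k=\{x\in X:\partial(x_0,x)=k\}$ ($\partial$ the graph distance), $D=\max_{x\in X}\partial(x_0,x)$, and let $Y_1,\dots,Y_r$ be the orbits on $X$ of the stabilizer of $x_0$ in $\mathrm{Aut}(\Gamma)$. Then $\mathcal{T}_2(\Gamma,x_0)=\mathbb{C}\langle A,E_{X_0},\dots,E_{X_D}\rangle$ and $\mathcal{T}_3(\Gamma,x_0)=\mathbb{C}\langle A,E_{Y_1},\dots,E_{Y_r}\rangle$. These definitions apply also to $\Gamma'$ with base vertex $x_1$. "Belongs to a summand" means that the image of the idempotent under the isomorphism lies in that matrix summand. *)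

theory Defs
  imports
    Complex_Main
    "HOL.Hull"
    "HOL-Combinatorics.Permutations"
    "HOL-Algebra.QuotRing"
    "Jordan_Normal_Form.Matrix"
begin

section \<open>Graphs\<close>

text \<open>A graph is given by its vertex set \<open>X\<close> and its set \<open>E\<close> of two-element edges.\<close>

definition simple_graph :: "'a set \<Rightarrow> 'a set set \<Rightarrow> bool" where
  "simple_graph X E \<longleftrightarrow> finite X \<and> (\<forall>e\<in>E. e \<subseteq> X \<and> card e = 2)"

definition adj_rel :: "'a set set \<Rightarrow> ('a \<times> 'a) set" where
  "adj_rel E = {(x, y). {x, y} \<in> E}"

definition connected_graph :: "'a set \<Rightarrow> 'a set set \<Rightarrow> bool" where
  "connected_graph X E \<longleftrightarrow> X \<noteq> {} \<and> (\<forall>x\<in>X. \<forall>y\<in>X. (x, y) \<in> (adj_rel E)\<^sup>*)"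

definition valency :: "'a set \<Rightarrow> 'a set set \<Rightarrow> 'a \<Rightarrow> nat" where
  "valency X E x = card {y \<in> X. {x, y} \<in> E}"

text \<open>Pairs in \<open>adj_rel E ^^ k\<close> are the pairs of end points of walks of length \<open>k\<close>.\<close>

definition graph_dist :: "'a set set \<Rightarrow> 'a \<Rightarrow> 'a \<Rightarrow> nat" where
  "graph_dist E x y = (LEAST k. (x, y) \<in> adj_rel E ^^ k)"

definition graph_sphere :: "'a set \<Rightarrow> 'a set set \<Rightarrow> 'a \<Rightarrow> nat \<Rightarrow> 'a set" where
  "graph_sphere X E x0 k = {x \<in> X. graph_dist E x0 x = k}"

definition eccentricity :: "'a set \<Rightarrow> 'a set set \<Rightarrow> 'a \<Rightarrow> nat" where
  "eccentricity X E x0 = Max (graph_dist E x0 ` X)"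

definition graph_aut :: "'a set \<Rightarrow> 'a set set \<Rightarrow> ('a \<Rightarrow> 'a) set" where
  "graph_aut X E = {g. g permutes X \<and> (\<forall>x\<in>X. \<forall>y\<in>X. {g x, g y} \<in> E \<longleftrightarrow> {x, y} \<in> E)}"

definition stabilizer_orbits :: "'a set \<Rightarrow> 'a set set \<Rightarrow> 'a \<Rightarrow> 'a set set" where
  "stabilizer_orbits X E x0 = {{g x | g. g \<in> graph_aut X E \<and> g x0 = x0} | x. x \<in> X}"


section \<open>Complex algebras\<close>

text \<open>A \<open>\<complex>\<close>-algebra is a record of type \<open>(complex, 'b) module\<close>; the locale \<open>algebra\<close> of
  HOL-Algebra is not used because it requires a commutative multiplication.\<close>

definition unital_subalgebra :: "(complex, 'b) module \<Rightarrow> 'b set \<Rightarrow> bool" where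
  "unital_subalgebra A S \<longleftrightarrow> S \<subseteq> carrier A \<and> \<one>\<^bsub>A\<^esub> \<in> S \<and>
     (\<forall>x\<in>S. \<forall>y\<in>S. x \<oplus>\<^bsub>A\<^esub> y \<in> S \<and> x \<otimes>\<^bsub>A\<^esub> y \<in> S) \<and>
     (\<forall>c. \<forall>x\<in>S. c \<odot>\<^bsub>A\<^esub> x \<in> S)"

definition generated_algebra :: "(complex, 'b) module \<Rightarrow> 'b set \<Rightarrow> (complex, 'b) module" where
  "generated_algebra A S = A\<lparr>carrier := unital_subalgebra A hull S\<rparr>"

definition algebra_iso ::
    "(complex, 'b) module \<Rightarrow> (complex, 'c) module \<Rightarrow> ('b \<Rightarrow> 'c) set" where
  "algebra_iso A B = {h \<in> ring_iso A B.
     \<forall>c. \<forall>x\<in>carrier A. h (c \<odot>\<^bsub>A\<^esub> x) = c \<odot>\<^bsub>B\<^esub> h x}"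

definition primitive_idempotent :: "(complex, 'b) module \<Rightarrow> 'b \<Rightarrow> bool" where
  "primitive_idempotent A e \<longleftrightarrow> e \<in> carrier A \<and> e \<otimes>\<^bsub>A\<^esub> e = e \<and> e \<noteq> \<zero>\<^bsub>A\<^esub> \<and>
     (\<forall>f\<in>carrier A. \<forall>g\<in>carrier A.
        f \<otimes>\<^bsub>A\<^esub> f = f \<and> g \<otimes>\<^bsub>A\<^esub> g = g \<and> f \<otimes>\<^bsub>A\<^esub> g = \<zero>\<^bsub>A\<^esub> \<and> g \<otimes>\<^bsub>A\<^esub> f = \<zero>\<^bsub>A\<^esub> \<and>
        e = f \<oplus>\<^bsub>A\<^esub> g \<longrightarrow> f = \<zero>\<^bsub>A\<^esub> \<or> g = \<zero>\<^bsub>A\<^esub>)"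

definition direct_sum_algebra ::
    "'i set \<Rightarrow> ('i \<Rightarrow> (complex, 'b) module) \<Rightarrow> (complex, 'i \<Rightarrow> 'b) module" where
  "direct_sum_algebra I A = \<lparr>
     carrier = (\<Pi>\<^sub>E i\<in>I. carrier (A i)),
     monoid.mult = (\<lambda>x y. \<lambda>i\<in>I. x i \<otimes>\<^bsub>A i\<^esub> y i),
     one = (\<lambda>i\<in>I. \<one>\<^bsub>A i\<^esub>),
     zero = (\<lambda>i\<in>I. \<zero>\<^bsub>A i\<^esub>),
     add = (\<lambda>x y. \<lambda>i\<in>I. x i \<oplus>\<^bsub>A i\<^esub> y i),
     smult = (\<lambda>c x. \<lambda>i\<in>I. c \<odot>\<^bsub>A i\<^esub> x i)\<rparr>"

definition summand ::
    "'i set \<Rightarrow> ('i \<Rightarrow> (complex, 'b) module) \<Rightarrow> 'i \<Rightarrow> ('i \<Rightarrow> 'b) set" where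
  "summand I A j = {x \<in> carrier (direct_sum_algebra I A). \<forall>i\<in>I. i \<noteq> j \<longrightarrow> x i = \<zero>\<^bsub>A i\<^esub>}"

abbreviation full_matrix_algebra :: "nat \<Rightarrow> (complex, complex mat) module" where
  "full_matrix_algebra n \<equiv> module_mat TYPE(complex) n n"


section \<open>Matrices indexed by a vertex set\<close>

text \<open>A matrix with rows and columns indexed by \<open>X\<close> is a function on pairs of vertices that is
  extended by 0 outside \<open>X \<times> X\<close>.\<close>

definition matrix_algebra_on :: "'a set \<Rightarrow> (complex, 'a \<Rightarrow> 'a \<Rightarrow> complex) module" where
  "matrix_algebra_on X = \<lparr>
     carrier = {M. \<forall>x y. M x y \<noteq> 0 \<longrightarrow> x \<in> X \<and> y \<in> X},
     monoid.mult = (\<lambda>M N x y. \<Sum>z\<in>X. M x z * N z y),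
     one = (\<lambda>x y. if x = y \<and> x \<in> X then 1 else 0),
     zero = (\<lambda>x y. 0),
     add = (\<lambda>M N x y. M x y + N x y),
     smult = (\<lambda>c M x y. c * M x y)\<rparr>"

definition adj_matrix :: "'a set set \<Rightarrow> 'a \<Rightarrow> 'a \<Rightarrow> complex" where
  "adj_matrix E x y = (if {x, y} \<in> E then 1 else 0)"

definition diag_idem :: "'a set \<Rightarrow> 'a \<Rightarrow> 'a \<Rightarrow> complex" where
  "diag_idem Y x y = (if x = y \<and> x \<in> Y then 1 else 0)"


section \<open>The algebras \<open>\<T>\<^sub>2\<close> and \<open>\<T>\<^sub>3\<close>\<close>

definition terwilliger2 ::
    "'a set \<Rightarrow> 'a set set \<Rightarrow> 'a \<Rightarrow> (complex, 'a \<Rightarrow> 'a \<Rightarrow> complex) module" where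
  "terwilliger2 X E x0 = generated_algebra (matrix_algebra_on X)
     (insert (adj_matrix E)
       {diag_idem (graph_sphere X E x0 k) | k. k \<le> eccentricity X E x0})"

definition terwilliger3 ::
    "'a set \<Rightarrow> 'a set set \<Rightarrow> 'a \<Rightarrow> (complex, 'a \<Rightarrow> 'a \<Rightarrow> complex) module" where
  "terwilliger3 X E x0 = generated_algebra (matrix_algebra_on X)
     (insert (adj_matrix E) (diag_idem ` stabilizer_orbits X E x0))"

text \<open>Only the values \<open>l = 2\<close> and \<open>l = 3\<close> are meaningful.\<close>

definition terwilliger ::
    "nat \<Rightarrow> 'a set \<Rightarrow> 'a set set \<Rightarrow> 'a \<Rightarrow> (complex, 'a \<Rightarrow> 'a \<Rightarrow> complex) module" where
  "terwilliger l = (if l = 2 then terwilliger2 else if l = 3 then terwilliger3 else undefined)"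

end

(*
  Write e for the idempotent at x1 and T' for the algebra of (Gamma', x1). A matrix on X belongs to
  the algebra T of (Gamma, x0) iff its restriction to X' lies in T' and its column and row at x0,
  moved to x1, lie in T' e and e T': distances from x0 exceed distances from x1 by one, both vertex
  stabilizers coincide, and compressing A by E_x0 and 1 - E_x0 yields A' and the matrix units between
  x0 and x1. In other words T is the corner f M_2(T') f with f = diag (1, e).

  Since e T' e = C e is one-dimensional, phi e is a rank-one idempotent u v^T (with
  v . u = 1) of the summand of size n 0. Then T' e and e T' are identified with columns and rows of
  length n 0, and these border the block of size n 0 to one of size n 0 + 1.
*)
theory Submission
  imports Defs
begin

section \<open>Distances and stabilizers at a pendant vertex\<close>

text \<open>The delicate point is the new corner entry, which corresponds to nothing in T' but a
  scalar. It is controlled through e T' e: a border row times a border column is a multiple of e,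
  and comparing images under phi turns that multiple into a dot product. The normalisation v . u = 1
  makes these contractions come out with factor one, in the corner as well as in the block of size n
  0.

  Membership of phi e in the summand of size n 0 has two effects. Together with injectivity it makes
  phi e nonzero on that block, so that u and v exist; and it kills the borders in the other
  summands, whose sizes therefore stay.

  The walks in Gamma' that define distances from x1 are obtained from walks in Gamma by cutting out
  excursions to x0. The distinction between the two values of l ends with the generators: spheres
  and orbits both supply subsets of X' with {x1} among them, together with {x0}.\<close>

lemma simple_graph_edge_neq:
  assumes "simple_graph X E" and "{x, y} \<in> E"
  shows "x \<noteq> y" and "x \<in> X" and "y \<in> X"
  using assms by (auto simp: simple_graph_def card_2_iff doubleton_eq_iff)

lemma relpow_mono:
  fixes R S :: "('a \<times> 'a) set"
  assumes "(x, y) \<in> R ^^ k" and "R \<subseteq> S"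
  shows "(x, y) \<in> S ^^ k"
  using assms(1)
proof (induction k arbitrary: y)
  case (Suc k)
  then obtain z where "(x, z) \<in> S ^^ k" "(z, y) \<in> R" by auto
  then show ?case using assms(2) by auto
qed simp

locale pendant_vertex =
  fixes X X' :: "'a set" and E E' :: "'a set set" and x0 x1 :: 'a
  assumes simple: "simple_graph X E" and conn: "connected_graph X E"
    and x0: "x0 \<in> X" and val: "valency X E x0 = 1"
    and x1: "x1 \<in> X" and edge: "{x0, x1} \<in> E"
    and X': "X' = X - {x0}" and E': "E' = E - {{x0, x1}}"
begin

lemma finite_X': "finite X'" and x0_notin: "x0 \<notin> X'" and X_eq: "X = insert x0 X'"
  using simple x0 by (auto simp: simple_graph_def X')

lemma x1_X': "x1 \<in> X'"
  using simple_graph_edge_neq[OF simple edge] by (auto simp: X')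

lemma edge_x0_iff: "{x0, y} \<in> E \<longleftrightarrow> y = x1" "{y, x0} \<in> E \<longleftrightarrow> y = x1"
proof -
  obtain z where "{y \<in> X. {x0, y} \<in> E} = {z}"
    using val by (auto simp: valency_def card_1_singleton_iff)
  moreover have "x1 \<in> {y \<in> X. {x0, y} \<in> E}" using x1 edge by simp
  ultimately have "{y \<in> X. {x0, y} \<in> E} = {x1}" by simp
  then show *: "{x0, y} \<in> E \<longleftrightarrow> y = x1"
    using simple_graph_edge_neq(3)[OF simple, of x0 y] by blast
  then show "{y, x0} \<in> E \<longleftrightarrow> y = x1" by (simp add: insert_commute)
qed

section \<open>Walks, distances and spheres seen from the pendant vertex\<close>

lemma edge'_iff: "{x, y} \<in> E' \<longleftrightarrow> {x, y} \<in> E \<and> x \<noteq> x0 \<and> y \<noteq> x0"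
  using edge_x0_iff by (auto simp: E' doubleton_eq_iff)

text \<open>A walk that enters \<open>x0\<close> can leave it only to \<open>x1\<close>, where it
  began, so everything up to that return can be discarded. Hence a bound on the length instead of
  equality.\<close>

lemma walk_avoiding_x0:
  assumes "(x1, y) \<in> adj_rel E ^^ k" and "y \<noteq> x0"
  shows "\<exists>j\<le>k. (x1, y) \<in> adj_rel E' ^^ j"
  using assms
proof (induction k arbitrary: y)
  case (Suc k)
  then obtain z where z: "(x1, z) \<in> adj_rel E ^^ k" "{z, y} \<in> E"
    by (auto simp: adj_rel_def)
  show ?case
  proof (cases "z = x0")
    case True
    then have "y = x1" using z edge_x0_iff by simp
    then show ?thesis by (intro exI[of _ 0]) auto
  next
    case False
    then obtain j where "j \<le> k" "(x1, z) \<in> adj_rel E' ^^ j" using Suc z by blast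
    moreover have "(z, y) \<in> adj_rel E'" using z False Suc by (simp add: adj_rel_def edge'_iff)
    ultimately show ?thesis by (intro exI[of _ "Suc j"]) auto
  qed
qed auto

lemma walk'_imp_walk: "(x1, y) \<in> adj_rel E' ^^ k \<Longrightarrow> (x0, y) \<in> adj_rel E ^^ Suc k"
proof -
  assume "(x1, y) \<in> adj_rel E' ^^ k"
  then have "(x1, y) \<in> adj_rel E ^^ k"
    by (rule relpow_mono) (auto simp: adj_rel_def E')
  moreover have "(x0, x1) \<in> adj_rel E" using edge by (simp add: adj_rel_def)
  ultimately show ?thesis by (blast intro: relpow_Suc_I2)
qed

text \<open>The first step out of \<open>x0\<close> must reach \<open>x1\<close>. Dropping it gives
  the strict bound, which is the source of the shift by one in all distances.\<close>

lemma walk_imp_walk':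
  assumes "(x0, y) \<in> adj_rel E ^^ k" and "y \<noteq> x0"
  shows "\<exists>j<k. (x1, y) \<in> adj_rel E' ^^ j"
proof (cases k)
  case (Suc k')
  then obtain z where "{x0, z} \<in> E" "(z, y) \<in> adj_rel E ^^ k'"
    using assms relpow_Suc_D2[of x0 y k' "adj_rel E"] by (auto simp: adj_rel_def)
  then have "\<exists>j\<le>k'. (x1, y) \<in> adj_rel E' ^^ j"
    using walk_avoiding_x0 assms edge_x0_iff by simp
  then show ?thesis using Suc by (auto intro: le_imp_less_Suc)
qed (use assms in auto)

lemma graph_dist_x0: "graph_dist E x0 x0 = 0"
  by (auto simp: graph_dist_def intro!: Least_eq_0)

lemma graph_dist_Suc:
  assumes "y \<in> X'"
  shows "graph_dist E x0 y = Suc (graph_dist E' x1 y)"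
proof -
  have "y \<noteq> x0" "y \<in> X" using assms by (auto simp: X')
  \<comment> \<open>\<open>graph_dist\<close> is a least number and tells something only if a walk
    exists; the walk in the smaller graph is obtained from connectedness of the larger one.\<close>
  have "(x0, y) \<in> (adj_rel E)\<^sup>*" using conn x0 \<open>y \<in> X\<close> by (auto simp: connected_graph_def)
  then obtain k where "(x0, y) \<in> adj_rel E ^^ k" by (auto simp: rtrancl_power)
  then obtain j where "(x1, y) \<in> adj_rel E' ^^ j" using walk_imp_walk' \<open>y \<noteq> x0\<close> by blast
  then have L: "(x1, y) \<in> adj_rel E' ^^ graph_dist E' x1 y"
    unfolding graph_dist_def by (rule LeastI)
  show ?thesis
    unfolding graph_dist_def[of E x0]
  proof (rule Least_equality)
    show "(x0, y) \<in> adj_rel E ^^ Suc (graph_dist E' x1 y)" using L by (rule walk'_imp_walk)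
    fix k assume "(x0, y) \<in> adj_rel E ^^ k"
    then obtain j where "j < k" "(x1, y) \<in> adj_rel E' ^^ j"
      using walk_imp_walk' \<open>y \<noteq> x0\<close> by blast
    then show "Suc (graph_dist E' x1 y) \<le> k"
      unfolding graph_dist_def by (meson Least_le le_less_trans Suc_leI)
  qed
qed

lemma graph_sphere_0: "graph_sphere X E x0 0 = {x0}"
  by (auto simp: graph_sphere_def X_eq graph_dist_x0 graph_dist_Suc)

lemma graph_sphere_Suc: "graph_sphere X E x0 (Suc k) = graph_sphere X' E' x1 k"
  by (auto simp: graph_sphere_def X_eq graph_dist_x0 graph_dist_Suc)

lemma eccentricity_Suc: "eccentricity X E x0 = Suc (eccentricity X' E' x1)"
proof -
  have ne: "X' \<noteq> {}" using x1_X' by auto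
  have "graph_dist E x0 ` X = insert 0 (Suc ` (graph_dist E' x1 ` X'))"
    by (auto simp: X_eq graph_dist_x0 graph_dist_Suc image_image)
  then have "eccentricity X E x0 = Max (Suc ` (graph_dist E' x1 ` X'))"
    using ne finite_X' by (simp add: eccentricity_def)
  also have "\<dots> = Suc (eccentricity X' E' x1)"
    unfolding eccentricity_def
    using ne finite_X' by (subst mono_Max_commute[symmetric]) (auto simp: mono_Suc)
  finally show ?thesis .
qed

lemma spheres_eq:
  "{diag_idem (graph_sphere X E x0 k) | k. k \<le> eccentricity X E x0} =
     insert (diag_idem {x0}) (diag_idem ` {graph_sphere X' E' x1 k | k. k \<le> eccentricity X' E' x1})"
  (is "?L = ?R")
proof -
  have "?L = (\<lambda>k. diag_idem (graph_sphere X E x0 k)) ` {..Suc (eccentricity X' E' x1)}"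
    by (auto simp: eccentricity_Suc)
  also have "\<dots> = ?R"
    by (auto simp: atMost_Suc_eq_insert_0 graph_sphere_0 graph_sphere_Suc image_image)
  finally show ?thesis .
qed

text \<open>This puts \<open>diag_idem {x1}\<close> among the generators for \<open>l = 2\<close>. A
  vertex at distance zero from \<open>x1\<close> is at distance one from \<open>x0\<close> in the
  larger graph, where an actual walk realises the distance, and that walk is an edge at
  \<open>x0\<close>.\<close>

lemma graph_sphere'_0: "graph_sphere X' E' x1 0 = {x1}"
proof -
  have "graph_dist E' x1 x1 = 0" by (auto simp: graph_dist_def intro!: Least_eq_0)
  moreover have "y = x1" if "y \<in> X'" "graph_dist E' x1 y = 0" for y
  proof -
    have "graph_dist E x0 y = 1" using that graph_dist_Suc by simp
    have "(x0, y) \<in> (adj_rel E)\<^sup>*"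
      using conn x0 that by (auto simp: connected_graph_def X')
    then obtain k where "(x0, y) \<in> adj_rel E ^^ k" by (auto simp: rtrancl_power)
    then have "(x0, y) \<in> adj_rel E ^^ graph_dist E x0 y"
      unfolding graph_dist_def by (rule LeastI)
    then show ?thesis
      using \<open>graph_dist E x0 y = 1\<close> edge_x0_iff by (simp add: adj_rel_def)
  qed
  ultimately show ?thesis using x1_X' by (auto simp: graph_sphere_def)
qed

text \<open>An automorphism fixing \<open>x0\<close> fixes its only neighbour. Conversely,
  \<open>permutes\<close> makes a permutation of \<open>X'\<close> the identity at
  \<open>x0\<close>, and the additional edge is preserved once \<open>x1\<close> is fixed. The same
  function serves both graphs, without a restriction or extension map.\<close>

lemma stabilizer_eq:
  "g \<in> graph_aut X E \<and> g x0 = x0 \<longleftrightarrow> g \<in> graph_aut X' E' \<and> g x1 = x1"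
proof
  assume g: "g \<in> graph_aut X E \<and> g x0 = x0"
  then have perm: "g permutes X" and
    adj: "\<And>x y. x \<in> X \<Longrightarrow> y \<in> X \<Longrightarrow> {g x, g y} \<in> E \<longleftrightarrow> {x, y} \<in> E"
    by (auto simp: graph_aut_def)
  have "{g x0, g x1} \<in> E" using adj x0 x1 edge by simp
  then have "g x1 = x1" using g edge_x0_iff by simp
  have inj: "g x = x0 \<longleftrightarrow> x = x0" for x using permutes_inj[OF perm] g by (metis injD)
  have "g permutes X'"
    using perm g permutes_superset[of g X X'] by (auto simp: X')
  moreover have "{g x, g y} \<in> E' \<longleftrightarrow> {x, y} \<in> E'" if "x \<in> X'" "y \<in> X'" for x y
    using adj that inj by (auto simp: edge'_iff X')
  ultimately show "g \<in> graph_aut X' E' \<and> g x1 = x1"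
    using \<open>g x1 = x1\<close> by (simp add: graph_aut_def)
next
  assume g: "g \<in> graph_aut X' E' \<and> g x1 = x1"
  then have perm: "g permutes X'" and
    adj: "\<And>x y. x \<in> X' \<Longrightarrow> y \<in> X' \<Longrightarrow> {g x, g y} \<in> E' \<longleftrightarrow> {x, y} \<in> E'"
    by (auto simp: graph_aut_def)
  have gx0: "g x0 = x0" using perm x0_notin by (simp add: permutes_not_in)
  have "g permutes X" using perm by (rule permutes_subset) (auto simp: X')
  have inj0: "g x = x0 \<longleftrightarrow> x = x0" and inj1: "g x = x1 \<longleftrightarrow> x = x1" for x
    using permutes_inj[OF perm] g gx0 by (metis injD)+
  have "{g x, g y} \<in> E \<longleftrightarrow> {x, y} \<in> E" if "x \<in> X" "y \<in> X" for x y
  proof (cases "x = x0 \<or> y = x0")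
    case True
    then show ?thesis using gx0 inj1[of x] inj1[of y] by (elim disjE) (simp_all add: edge_x0_iff)
  next
    case False
    then show ?thesis using adj[of x y] that inj0[of x] inj0[of y] by (simp add: edge'_iff X')
  qed
  then show "g \<in> graph_aut X E \<and> g x0 = x0"
    using \<open>g permutes X\<close> gx0 by (simp add: graph_aut_def)
qed

lemma stabilizer_orbits_eq:
  "stabilizer_orbits X E x0 = insert {x0} (stabilizer_orbits X' E' x1)"
proof -
  have "{g x0 | g. g \<in> graph_aut X' E' \<and> g x1 = x1} = {x0}"
  proof -
    have "id \<in> graph_aut X' E'" by (simp add: graph_aut_def permutes_id)
    moreover have "g x0 = x0" if "g \<in> graph_aut X' E'" for g
      using that x0_notin by (intro permutes_not_in[of g X']) (auto simp: graph_aut_def)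
    ultimately show ?thesis by (auto intro!: exI[of _ id])
  qed
  moreover have "{F x | x. x \<in> insert x0 X'} = insert (F x0) {F x | x. x \<in> X'}" for F :: "'a \<Rightarrow> 'a set"
    by auto
  ultimately show ?thesis
    unfolding stabilizer_orbits_def by (simp only: stabilizer_eq) (simp only: X_eq)
qed

lemma orbit_x1: "{x1} \<in> stabilizer_orbits X' E' x1"
proof -
  have "id \<in> graph_aut X' E'" by (simp add: graph_aut_def permutes_id)
  then have "{g x1 | g. g \<in> graph_aut X' E' \<and> g x1 = x1} = {x1}"
    by (auto intro!: exI[of _ id])
  then show ?thesis using x1_X' unfolding stabilizer_orbits_def by (intro CollectI exI[of _ x1] conjI) simp_all
qed

lemma stabilizer_orbits_subset: "Y \<in> stabilizer_orbits X' E' x1 \<Longrightarrow> Y \<subseteq> X'"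
  unfolding stabilizer_orbits_def graph_aut_def by (auto dest: permutes_in_image[THEN iffD2, rotated])

text \<open>This removes \<open>l\<close> from the algebraic argument, which sees only a family
  \<open>P\<close> of subsets of \<open>X'\<close> with \<open>{x1}\<close> among them; the larger
  algebra has the idempotent of \<open>x0\<close> in addition.\<close>

lemma terwilliger_generators:
  assumes "l \<in> {2, 3}"
  obtains P where "{x1} \<in> P" and "\<And>Y. Y \<in> P \<Longrightarrow> Y \<subseteq> X'"
    and "terwilliger l X' E' x1 =
      generated_algebra (matrix_algebra_on X') (insert (adj_matrix E') (diag_idem ` P))"
    and "terwilliger l X E x0 = generated_algebra (matrix_algebra_on X)
      (insert (adj_matrix E) (insert (diag_idem {x0}) (diag_idem ` P)))"
proof (cases "l = 2")
  case True
  let ?P = "{graph_sphere X' E' x1 k | k. k \<le> eccentricity X' E' x1}"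
  have img: "diag_idem ` ?P = {diag_idem (graph_sphere X' E' x1 k) | k. k \<le> eccentricity X' E' x1}"
    by auto
  have ter: "terwilliger l = terwilliger2" using True by (simp add: terwilliger_def)
  show ?thesis
  proof (rule that[of ?P])
    show "{x1} \<in> ?P" using graph_sphere'_0 by force
    show "Y \<subseteq> X'" if "Y \<in> ?P" for Y using that by (auto simp: graph_sphere_def)
  qed (simp_all only: ter terwilliger2_def spheres_eq img)
next
  case False
  then have "l = 3" using assms by simp
  show ?thesis
    by (rule that[of "stabilizer_orbits X' E' x1"])
      (use orbit_x1 stabilizer_orbits_subset \<open>l = 3\<close> in
        \<open>simp_all add: terwilliger_def terwilliger3_def stabilizer_orbits_eq\<close>)
qed

end

section \<open>Matrix algebras bordered by one vertex\<close>

lemma unital_subalgebraD: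
  assumes "unital_subalgebra A S"
  shows "S \<subseteq> carrier A" and "\<one>\<^bsub>A\<^esub> \<in> S"
    and "x \<in> S \<Longrightarrow> y \<in> S \<Longrightarrow> x \<oplus>\<^bsub>A\<^esub> y \<in> S"
    and "x \<in> S \<Longrightarrow> y \<in> S \<Longrightarrow> x \<otimes>\<^bsub>A\<^esub> y \<in> S"
    and "x \<in> S \<Longrightarrow> c \<odot>\<^bsub>A\<^esub> x \<in> S"
  using assms by (auto simp: unital_subalgebra_def)

lemma unital_subalgebra_hull:
  assumes "unital_subalgebra A (carrier A)" and "G \<subseteq> carrier A"
  shows "unital_subalgebra A (unital_subalgebra A hull G)"
  unfolding unital_subalgebra_def[of A "_ hull _"]
proof (intro conjI ballI allI)
  show "unital_subalgebra A hull G \<subseteq> carrier A"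
    using assms by (simp add: hull_minimal)
qed (auto simp: hull_def unital_subalgebraD)

lemma matrix_algebra_on_carrier:
  "M \<in> carrier (matrix_algebra_on X) \<longleftrightarrow> (\<forall>x y. M x y \<noteq> 0 \<longrightarrow> x \<in> X \<and> y \<in> X)"
  by (simp add: matrix_algebra_on_def)

lemma matrix_algebra_on_simps:
  "M \<otimes>\<^bsub>matrix_algebra_on X\<^esub> N = (\<lambda>x y. \<Sum>z\<in>X. M x z * N z y)"
  "\<one>\<^bsub>matrix_algebra_on X\<^esub> = diag_idem X"
  "\<zero>\<^bsub>matrix_algebra_on X\<^esub> = (\<lambda>x y. 0)"
  "M \<oplus>\<^bsub>matrix_algebra_on X\<^esub> N = (\<lambda>x y. M x y + N x y)"
  "c \<odot>\<^bsub>matrix_algebra_on X\<^esub> M = (\<lambda>x y. c * M x y)"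
  by (simp_all add: matrix_algebra_on_def diag_idem_def fun_eq_iff)

lemma unital_subalgebra_matrix_carrier:
  "unital_subalgebra (matrix_algebra_on X) (carrier (matrix_algebra_on X))"
proof -
  let ?C = "carrier (matrix_algebra_on X)"
  have "(\<lambda>x y. \<Sum>z\<in>X. M x z * N z y) \<in> ?C" if "M \<in> ?C" "N \<in> ?C" for M N
    unfolding matrix_algebra_on_carrier
  proof (intro allI impI)
    fix x y
    assume "(\<Sum>z\<in>X. M x z * N z y) \<noteq> 0"
    then have "\<exists>z. M x z * N z y \<noteq> 0" by (meson sum.neutral)
    then show "x \<in> X \<and> y \<in> X" using that by (auto simp: matrix_algebra_on_carrier)
  qed
  moreover have "(\<lambda>x y. M x y + N x y) \<in> ?C" if "M \<in> ?C" "N \<in> ?C" for M N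
    unfolding matrix_algebra_on_carrier
  proof (intro allI impI)
    fix x y
    assume "M x y + N x y \<noteq> 0"
    then have "M x y \<noteq> 0 \<or> N x y \<noteq> 0" by auto
    then show "x \<in> X \<and> y \<in> X" using that by (auto simp: matrix_algebra_on_carrier)
  qed
  moreover have "(\<lambda>x y. c * M x y) \<in> ?C" if "M \<in> ?C" for c M
    using that by (auto simp: matrix_algebra_on_carrier)
  moreover have "diag_idem X \<in> ?C"
    by (simp add: matrix_algebra_on_carrier diag_idem_def)
  ultimately show ?thesis
    by (simp add: unital_subalgebra_def matrix_algebra_on_simps)
qed

lemma diag_idem_carrier: "Y \<subseteq> X \<Longrightarrow> diag_idem Y \<in> carrier (matrix_algebra_on X)"
  by (auto simp: diag_idem_def matrix_algebra_on_carrier)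

text \<open>\<open>unital_subalgebra\<close> does not list the zero; scaling the unit by 0 supplies
  it.\<close>

lemma unital_subalgebra_zero:
  assumes "unital_subalgebra (matrix_algebra_on X) S"
  shows "(\<lambda>x y. 0) \<in> S"
  using unital_subalgebraD(5)[OF assms unital_subalgebraD(2)[OF assms], of 0]
  by (simp add: matrix_algebra_on_simps)

lemma sum_diag_idem:
  assumes "finite X"
  shows "(\<Sum>z\<in>X. diag_idem Y x z * f z) = (if x \<in> X \<and> x \<in> Y then f x else 0)"
    and "(\<Sum>z\<in>X. f z * diag_idem Y z y) = (if y \<in> X \<and> y \<in> Y then f y else 0)"
proof -
  have "(\<Sum>z\<in>X. diag_idem Y x z * f z) = (\<Sum>z\<in>X. if x = z then (if x \<in> Y then f x else 0) else 0)"
    by (intro sum.cong) (auto simp: diag_idem_def)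
  then show "(\<Sum>z\<in>X. diag_idem Y x z * f z) = (if x \<in> X \<and> x \<in> Y then f x else 0)"
    using assms by simp
  have "(\<Sum>z\<in>X. f z * diag_idem Y z y) = (\<Sum>z\<in>X. if z = y then (if y \<in> Y then f y else 0) else 0)"
    by (intro sum.cong) (auto simp: diag_idem_def)
  then show "(\<Sum>z\<in>X. f z * diag_idem Y z y) = (if y \<in> X \<and> y \<in> Y then f y else 0)"
    using assms by simp
qed

text \<open>From e = f + g with f and g orthogonal and f idempotent follows e f = f = f e, so f
  lives in the single entry at \<open>x0\<close>, and an idempotent scalar is 0 or 1. The argument
  takes place among all matrices on \<open>X\<close>, so every \<open>S\<close> containing the
  idempotent inherits primitivity.\<close>

lemma primitive_idempotent_vertex:
  assumes "finite X" and "x0 \<in> X" and "S \<subseteq> carrier (matrix_algebra_on X)"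
    and "diag_idem {x0} \<in> S"
  shows "primitive_idempotent ((matrix_algebra_on X)\<lparr>carrier := S\<rparr>) (diag_idem {x0})"
proof -
  let ?e = "diag_idem {x0} :: 'a \<Rightarrow> 'a \<Rightarrow> complex"
  have idem: "(\<lambda>x y. \<Sum>z\<in>X. ?e x z * ?e z y) = ?e"
    unfolding sum_diag_idem[OF assms(1)] using assms(2) by (auto simp: diag_idem_def fun_eq_iff)
  have nz: "?e \<noteq> (\<lambda>x y. 0)"
    by (auto simp: diag_idem_def fun_eq_iff)
  have prim: "f = (\<lambda>x y. 0) \<or> g = (\<lambda>x y. 0)"
    if ff: "(\<lambda>x y. \<Sum>z\<in>X. f x z * f z y) = f"
      and fg: "(\<lambda>x y. \<Sum>z\<in>X. f x z * g z y) = (\<lambda>x y. 0)"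
      and gf: "(\<lambda>x y. \<Sum>z\<in>X. g x z * f z y) = (\<lambda>x y. 0)"
      and e: "?e = (\<lambda>x y. f x y + g x y)" for f g
  proof -
    have mult_e: "(\<Sum>z\<in>X. f x z * ?e z y) = f x y" "(\<Sum>z\<in>X. ?e x z * f z y) = f x y" for x y
      using fun_cong[OF fun_cong[OF ff], of x y] fun_cong[OF fun_cong[OF fg], of x y]
        fun_cong[OF fun_cong[OF gf], of x y]
      by (simp_all add: e distrib_left distrib_right sum.distrib)
    have supp: "f x y = (if x = x0 \<and> y = x0 then f x0 x0 else 0)" for x y
      using mult_e[of x y] assms(2) unfolding sum_diag_idem[OF assms(1)] by (auto split: if_splits)
    have "f x0 z * f z x0 = (if z = x0 then f x0 x0 * f x0 x0 else 0)" for z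
      using supp[of x0 z] by (cases "z = x0") simp_all
    then have "(\<Sum>z\<in>X. f x0 z * f z x0) = (\<Sum>z\<in>X. if z = x0 then f x0 x0 * f x0 x0 else 0)"
      by simp
    also have "\<dots> = f x0 x0 * f x0 x0" using assms by simp
    finally have "f x0 x0 * f x0 x0 = f x0 x0"
      using fun_cong[OF fun_cong[OF ff], of x0 x0] by simp
    then consider "f x0 x0 = 0" | "f x0 x0 = 1" by auto
    then show ?thesis
    proof cases
      case 1
      have "f x y = 0" for x y using supp[of x y] 1 by (simp split: if_splits)
      then show ?thesis by (simp add: fun_eq_iff)
    next
      case 2
      have "g x y = 0" for x y
      proof -
        have "(if x = x0 \<and> y = x0 then 1 else 0) = f x y + g x y"
          using e[unfolded fun_eq_iff, rule_format, of x y]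
          by (cases "x = x0"; cases "y = x0") (auto simp: diag_idem_def split: if_splits)
        then show ?thesis using supp[of x y] 2 by (simp split: if_splits)
      qed
      then show ?thesis by (simp add: fun_eq_iff)
    qed
  qed
  show ?thesis
    unfolding primitive_idempotent_def
    using assms(4) idem nz prim by (simp add: matrix_algebra_on_simps)
qed

section \<open>Block decomposition at the added vertex\<close>

locale vertex_extension =
  fixes X' :: "'a set" and x0 x1 :: 'a
  assumes finite_X': "finite X'" and x0_notin: "x0 \<notin> X'" and x1_X': "x1 \<in> X'"
begin

text \<open>\<open>col0\<close> moves the column of \<open>x0\<close> to \<open>x1\<close>, and \<open>row0\<close> does the same with the row, so that all
  blocks of a matrix except the corner entry live in the algebra of matrices on \<open>X'\<close>.\<close>

definition restr :: "('a \<Rightarrow> 'a \<Rightarrow> complex) \<Rightarrow> 'a \<Rightarrow> 'a \<Rightarrow> complex" where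
  "restr M = (\<lambda>x y. if x \<in> X' \<and> y \<in> X' then M x y else 0)"

definition col0 :: "('a \<Rightarrow> 'a \<Rightarrow> complex) \<Rightarrow> 'a \<Rightarrow> 'a \<Rightarrow> complex" where
  "col0 M = (\<lambda>x y. if x \<in> X' \<and> y = x1 then M x x0 else 0)"

definition row0 :: "('a \<Rightarrow> 'a \<Rightarrow> complex) \<Rightarrow> 'a \<Rightarrow> 'a \<Rightarrow> complex" where
  "row0 M = (\<lambda>x y. if x = x1 \<and> y \<in> X' then M x0 y else 0)"

text \<open>The entry at \<open>x0\<close>, \<open>x0\<close> carries no condition: if
  \<open>S\<close> contains the idempotent of \<open>x1\<close>, the corner of \<open>S\<close> cut
  out by it consists of all its scalar multiples.\<close>

definition extend :: "('a \<Rightarrow> 'a \<Rightarrow> complex) set \<Rightarrow> ('a \<Rightarrow> 'a \<Rightarrow> complex) set" where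
  "extend S = {M \<in> carrier (matrix_algebra_on (insert x0 X')).
     restr M \<in> S \<and> col0 M \<in> S \<and> row0 M \<in> S}"

abbreviation mult' (infixl "\<odot>''" 70) where
  "M \<odot>' N \<equiv> (\<lambda>x y. \<Sum>z\<in>X'. M x z * N z y)"

abbreviation mult0 (infixl "\<odot>0" 70) where
  "M \<odot>0 N \<equiv> (\<lambda>x y. \<Sum>z\<in>insert x0 X'. M x z * N z y)"

lemma sum_insert_x0: "(\<Sum>z\<in>insert x0 X'. f z) = f x0 + (\<Sum>z\<in>X'. f z :: complex)"
  using finite_X' x0_notin by simp

lemma sum_delta_x1:
  "(\<Sum>z\<in>X'. (if x \<in> X' \<and> z = x1 then a else 0) * g z) = (if x \<in> X' then a * g x1 else (0::complex))"
proof -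
  have "(\<Sum>z\<in>X'. (if x \<in> X' \<and> z = x1 then a else 0) * g z) =
      (\<Sum>z\<in>X'. if z = x1 then (if x \<in> X' then a * g x1 else 0) else 0)"
    by (intro sum.cong) auto
  then show ?thesis
    using finite_X' x1_X' by simp
qed

text \<open>The terms of the product that pass through \<open>x0\<close> become a product inside
  \<open>X'\<close>, because the two shifted factors meet only at the index
  \<open>x1\<close>.\<close>

lemma restr_mult: "restr (M \<odot>0 N) = (\<lambda>x y. (restr M \<odot>' restr N) x y + (col0 M \<odot>' row0 N) x y)"
proof (intro ext)
  fix x y
  have "(\<Sum>z\<in>X'. restr M x z * restr N z y) = (if x \<in> X' \<and> y \<in> X' then \<Sum>z\<in>X'. M x z * N z y else 0)"
    by (auto simp: restr_def intro!: sum.cong)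
  moreover have "(\<Sum>z\<in>X'. col0 M x z * row0 N z y) = (if x \<in> X' \<and> y \<in> X' then M x x0 * N x0 y else 0)"
    unfolding col0_def sum_delta_x1 by (simp add: row0_def)
  ultimately show "restr (M \<odot>0 N) x y = (restr M \<odot>' restr N) x y + (col0 M \<odot>' row0 N) x y"
    by (simp add: restr_def sum_insert_x0)
qed

lemma col0_mult: "col0 (M \<odot>0 N) = (\<lambda>x y. (restr M \<odot>' col0 N) x y + N x0 x0 * col0 M x y)"
proof (intro ext)
  fix x y
  have "(\<Sum>z\<in>X'. restr M x z * col0 N z y) = (if x \<in> X' \<and> y = x1 then \<Sum>z\<in>X'. M x z * N z x0 else 0)"
    by (auto simp: restr_def col0_def intro!: sum.cong)
  then show "col0 (M \<odot>0 N) x y = (restr M \<odot>' col0 N) x y + N x0 x0 * col0 M x y"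
    by (simp add: col0_def sum_insert_x0)
qed

lemma row0_mult: "row0 (M \<odot>0 N) = (\<lambda>x y. (row0 M \<odot>' restr N) x y + M x0 x0 * row0 N x y)"
proof (intro ext)
  fix x y
  have "(\<Sum>z\<in>X'. row0 M x z * restr N z y) = (if x = x1 \<and> y \<in> X' then \<Sum>z\<in>X'. M x0 z * N z y else 0)"
    by (auto simp: restr_def row0_def intro!: sum.cong)
  then show "row0 (M \<odot>0 N) x y = (row0 M \<odot>' restr N) x y + M x0 x0 * row0 N x y"
    by (simp add: row0_def sum_insert_x0)
qed

text \<open>The corner entry has no block of its own in \<open>S\<close>. This identity makes the
  part that a product collects over \<open>X'\<close> visible there, as a coefficient of the
  idempotent of \<open>x1\<close>.\<close>

lemma row0_col0_mult:
  "(row0 M \<odot>' col0 N) = (\<lambda>x y. ((M \<odot>0 N) x0 x0 - M x0 x0 * N x0 x0) * diag_idem {x1} x y)"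
proof (intro ext)
  fix x y
  have "(row0 M \<odot>' col0 N) x y = (if x = x1 \<and> y = x1 then \<Sum>z\<in>X'. M x0 z * N z x0 else 0)"
    by (auto simp: col0_def row0_def intro!: sum.cong)
  then show "(row0 M \<odot>' col0 N) x y = ((M \<odot>0 N) x0 x0 - M x0 x0 * N x0 x0) * diag_idem {x1} x y"
    by (cases "x = x1"; cases "y = x1") (simp_all add: sum_insert_x0 diag_idem_def)
qed

lemma blocks_add:
  "restr (\<lambda>x y. M x y + N x y) = (\<lambda>x y. restr M x y + restr N x y)"
  "col0 (\<lambda>x y. M x y + N x y) = (\<lambda>x y. col0 M x y + col0 N x y)"
  "row0 (\<lambda>x y. M x y + N x y) = (\<lambda>x y. row0 M x y + row0 N x y)"
  by (auto simp: restr_def col0_def row0_def fun_eq_iff)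

lemma blocks_smult:
  "restr (\<lambda>x y. c * M x y) = (\<lambda>x y. c * restr M x y)"
  "col0 (\<lambda>x y. c * M x y) = (\<lambda>x y. c * col0 M x y)"
  "row0 (\<lambda>x y. c * M x y) = (\<lambda>x y. c * row0 M x y)"
  by (auto simp: restr_def col0_def row0_def fun_eq_iff)

lemma blocks_diag_idem:
  assumes "Y \<subseteq> insert x0 X'"
  shows "restr (diag_idem Y) = diag_idem (Y - {x0})"
    and "col0 (diag_idem Y) = (\<lambda>x y. 0)" and "row0 (diag_idem Y) = (\<lambda>x y. 0)"
  using assms x0_notin by (auto simp: restr_def col0_def row0_def diag_idem_def fun_eq_iff)

text \<open>Shifted columns lie in a left ideal generated by the idempotent of \<open>x1\<close>,
  shifted rows in the right ideal. This is what later forces the images of the borders into the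
  forms w v^T and u w^T.\<close>

lemma col0_mult_e: "col0 M \<odot>' diag_idem {x1} = col0 M"
  unfolding sum_diag_idem[OF finite_X'] using x1_X' by (auto simp: col0_def fun_eq_iff)

lemma e_mult_row0: "diag_idem {x1} \<odot>' row0 M = row0 M"
  unfolding sum_diag_idem[OF finite_X'] using x1_X' by (auto simp: row0_def fun_eq_iff)

lemma unital_subalgebra_extend:
  assumes S: "unital_subalgebra (matrix_algebra_on X') S"
  shows "unital_subalgebra (matrix_algebra_on (insert x0 X')) (extend S)"
proof -
  note closed = unital_subalgebraD[OF S, unfolded matrix_algebra_on_simps]
    unital_subalgebra_zero[OF S]
  note closedC = unital_subalgebraD[OF unital_subalgebra_matrix_carrier,
      unfolded matrix_algebra_on_simps]
  have "insert x0 X' - {x0} = X'" using x0_notin by auto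
  then show ?thesis
    unfolding unital_subalgebra_def matrix_algebra_on_simps
    by (auto simp only: extend_def mem_Collect_eq restr_mult col0_mult row0_mult blocks_add
        blocks_smult blocks_diag_idem subset_refl closed intro!: closed closedC)
qed

lemma diag_idem_mult_idem:
  assumes "A \<in> carrier (matrix_algebra_on (insert x0 X'))"
  shows "diag_idem Y \<odot>0 (A \<odot>0 diag_idem Z) = (\<lambda>x y. if x \<in> Y \<and> y \<in> Z then A x y else 0)"
proof -
  have "finite (insert x0 X')" using finite_X' by simp
  then show ?thesis
    using assms unfolding sum_diag_idem[OF \<open>finite (insert x0 X')\<close>]
    by (auto simp: matrix_algebra_on_carrier fun_eq_iff)
qed

text \<open>The matrix units between \<open>x0\<close> and \<open>x1\<close> undo the shifts of
  \<open>col0\<close> and \<open>row0\<close>. So a subalgebra with these units and the idempotent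
  of \<open>x0\<close> contains a matrix as soon as it contains its blocks; the formula also shows
  that the blocks determine the matrix.\<close>

lemma extend_decomposition:
  assumes "M \<in> carrier (matrix_algebra_on (insert x0 X'))"
  shows "M = (\<lambda>x y. restr M x y +
    ((col0 M \<odot>0 (\<lambda>x y. if x = x1 \<and> y = x0 then 1 else 0)) x y +
     (((\<lambda>x y. if x = x0 \<and> y = x1 then 1 else 0) \<odot>0 row0 M) x y + M x0 x0 * diag_idem {x0} x y)))"
proof (intro ext)
  fix x y
  have "(col0 M \<odot>0 (\<lambda>x y. if x = x1 \<and> y = x0 then 1 else 0)) x y =
      (\<Sum>z\<in>insert x0 X'. if z = x1 then (if x \<in> X' \<and> y = x0 then M x x0 else 0) else 0)"
    by (intro sum.cong) (auto simp: col0_def)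
  moreover have "((\<lambda>x y. if x = x0 \<and> y = x1 then 1 else 0) \<odot>0 row0 M) x y =
      (\<Sum>z\<in>insert x0 X'. if z = x1 then (if x = x0 \<and> y \<in> X' then M x0 y else 0) else 0)"
    by (intro sum.cong) (auto simp: row0_def)
  ultimately show "M x y = restr M x y +
    ((col0 M \<odot>0 (\<lambda>x y. if x = x1 \<and> y = x0 then 1 else 0)) x y +
     (((\<lambda>x y. if x = x0 \<and> y = x1 then 1 else 0) \<odot>0 row0 M) x y + M x0 x0 * diag_idem {x0} x y))"
    using assms finite_X' x1_X' x0_notin
    by (auto simp: restr_def diag_idem_def matrix_algebra_on_carrier)
qed

text \<open>One inclusion concerns only the generators, as the right side is a subalgebra. For the
  other, every factor in \<open>extend_decomposition\<close> has to be produced; the hypotheses on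
  the row and column of \<open>A\<close> at \<open>x0\<close> make its off-diagonal compressions
  exactly the matrix units.\<close>

lemma hull_eq_extend:
  assumes P: "{x1} \<in> P" "\<And>Y. Y \<in> P \<Longrightarrow> Y \<subseteq> X'"
    and A': "A' \<in> carrier (matrix_algebra_on X')"
    and A: "A \<in> carrier (matrix_algebra_on (insert x0 X'))"
    and restr_A: "restr A = A'" and A_x0: "\<And>y. A x0 y = (if y = x1 then 1 else 0)"
      "\<And>x. A x x0 = (if x = x1 then 1 else 0)"
  shows "unital_subalgebra (matrix_algebra_on (insert x0 X')) hull
      (insert A (insert (diag_idem {x0}) (diag_idem ` P))) =
    extend (unital_subalgebra (matrix_algebra_on X') hull (insert A' (diag_idem ` P)))"
    (is "?T = extend ?S")
proof
  have S: "unital_subalgebra (matrix_algebra_on X') ?S"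
    using A' P by (intro unital_subalgebra_hull unital_subalgebra_matrix_carrier)
      (auto intro!: diag_idem_carrier)
  have T: "unital_subalgebra (matrix_algebra_on (insert x0 X')) ?T"
    using A P by (intro unital_subalgebra_hull unital_subalgebra_matrix_carrier)
      (auto intro!: diag_idem_carrier)
  note cl = unital_subalgebraD[OF T, unfolded matrix_algebra_on_simps]
  have gen: "A' \<in> ?S" "Y \<in> P \<Longrightarrow> diag_idem Y \<in> ?S" for Y by (auto intro: hull_inc)
  have genT: "A \<in> ?T" "Y \<in> P \<Longrightarrow> diag_idem Y \<in> ?T" "diag_idem {x0} \<in> ?T" for Y
    by (auto intro: hull_inc)
  have col: "col0 A = diag_idem {x1}" and row: "row0 A = diag_idem {x1}"
    using x1_X' by (auto simp: col0_def row0_def A_x0 diag_idem_def fun_eq_iff)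
  have empty: "diag_idem {} = (\<lambda>x y. 0)" by (simp add: diag_idem_def fun_eq_iff)
  have "A \<in> extend ?S"
    using A restr_A col row gen P(1) by (simp add: extend_def)
  moreover have "diag_idem {x0} \<in> extend ?S"
    using unital_subalgebra_zero[OF S]
    by (simp add: extend_def blocks_diag_idem diag_idem_carrier empty)
  moreover have "diag_idem Y \<in> extend ?S" if "Y \<in> P" for Y
  proof -
    have "Y - {x0} = Y" "Y \<subseteq> insert x0 X'" using P(2)[OF that] x0_notin by auto
    then show ?thesis
      using unital_subalgebra_zero[OF S] gen(2)[OF that]
      by (simp add: extend_def blocks_diag_idem diag_idem_carrier)
  qed
  ultimately show "?T \<subseteq> extend ?S"
    by (intro hull_minimal unital_subalgebra_extend[OF S]) auto

  \<comment> \<open>The idempotent complementary to that of \<open>x0\<close>, with which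
    \<open>A\<close> is cut into blocks.\<close>
  have "(\<lambda>x y. diag_idem (insert x0 X') x y + (-1) * diag_idem {x0} x y) \<in> ?T"
    by (intro cl(2,3,5) genT)
  moreover have "(\<lambda>x y. diag_idem (insert x0 X') x y + (-1) * diag_idem {x0} x y) = diag_idem X'"
    using x0_notin by (auto simp: diag_idem_def fun_eq_iff)
  ultimately have one': "diag_idem X' \<in> ?T" by simp
  have "diag_idem X' \<odot>0 (A \<odot>0 diag_idem X') \<in> ?T" by (intro cl(4) genT one')
  then have A'_T: "A' \<in> ?T"
    unfolding diag_idem_mult_idem[OF A] using restr_A by (simp add: restr_def)
  \<comment> \<open>The intersection is a subalgebra with respect to another unit,
    \<open>diag_idem X'\<close>. The two products agree on it because a left factor on
    \<open>X'\<close> is zero in the column of \<open>x0\<close>.\<close>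
  have "unital_subalgebra (matrix_algebra_on X') (carrier (matrix_algebra_on X') \<inter> ?T)"
  proof -
    have "M \<odot>' N \<in> ?T" if "M \<in> carrier (matrix_algebra_on X')" "M \<in> ?T" "N \<in> ?T" for M N
    proof -
      have "M x x0 = 0" for x using that x0_notin by (auto simp: matrix_algebra_on_carrier)
      then show ?thesis using cl(4)[OF that(2,3)] by (simp add: sum_insert_x0)
    qed
    then show ?thesis
      using unital_subalgebraD[OF unital_subalgebra_matrix_carrier[of X'], unfolded matrix_algebra_on_simps]
      unfolding unital_subalgebra_def[of _ "carrier _ \<inter> _"] matrix_algebra_on_simps
      by (auto intro!: cl(3,5) one')
  qed
  moreover have "insert A' (diag_idem ` P) \<subseteq> carrier (matrix_algebra_on X') \<inter> ?T"
    using A' A'_T genT P by (auto intro!: diag_idem_carrier)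
  ultimately have S_T: "?S \<subseteq> ?T" by (blast dest: hull_minimal[of _ _ "unital_subalgebra _"])
  have "diag_idem X' \<odot>0 (A \<odot>0 diag_idem {x0}) \<in> ?T" by (intro cl(4) genT one')
  then have u10: "(\<lambda>x y. if x = x1 \<and> y = x0 then 1 else 0) \<in> ?T"
    unfolding diag_idem_mult_idem[OF A] using x1_X'
    by (elim back_subst[of "\<lambda>M. M \<in> ?T"]) (auto simp: A_x0 fun_eq_iff)
  have "diag_idem {x0} \<odot>0 (A \<odot>0 diag_idem X') \<in> ?T" by (intro cl(4) genT one')
  then have u01: "(\<lambda>x y. if x = x0 \<and> y = x1 then 1 else 0) \<in> ?T"
    unfolding diag_idem_mult_idem[OF A] using x1_X'
    by (elim back_subst[of "\<lambda>M. M \<in> ?T"]) (auto simp: A_x0 fun_eq_iff)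
  show "extend ?S \<subseteq> ?T"
  proof
    fix M assume M: "M \<in> extend ?S"
    then have "restr M \<in> ?T" "col0 M \<in> ?T" "row0 M \<in> ?T"
      using S_T by (auto simp: extend_def)
    then show "M \<in> ?T"
      using M by (subst extend_decomposition[of M]) (auto simp: extend_def intro!: cl u10 u01 genT)
  qed
qed

end

section \<open>Bordering a full matrix summand\<close>

text \<open>For a nonzero entry of p at (i, j), let Q be the matrix unit at (j, i). The (a, b) entry
  of p Q p is the product of the entries of p at (a, j) and (i, b), so p is column j times row i up
  to the scalar c. Position (i, j) itself shows that c is the chosen entry.\<close>

lemma rank_one_idempotent:
  fixes p :: "complex mat"
  assumes p: "p \<in> carrier_mat m m" and idem: "p * p = p" and nz: "p \<noteq> 0\<^sub>m m m"
    and corner: "\<And>Q. Q \<in> carrier_mat m m \<Longrightarrow> \<exists>c. p * Q * p = c \<cdot>\<^sub>m p"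
  obtains u v where "\<And>a b. a < m \<Longrightarrow> b < m \<Longrightarrow> p $$ (a, b) = u a * v b"
    and "(\<Sum>k<m. v k * u k) = 1"
proof -
  obtain i j where ij: "i < m" "j < m" "p $$ (i, j) \<noteq> 0"
    using nz p by (metis eq_matI carrier_matD index_zero_mat)
  define Q where "Q = mat m m (\<lambda>(a, b). if a = j \<and> b = i then 1 else 0 :: complex)"
  have Q: "Q \<in> carrier_mat m m" by (simp add: Q_def)
  obtain c where c: "p * Q * p = c \<cdot>\<^sub>m p" using corner[OF Q] ..
  have pQ: "(p * Q) $$ (a, k) = (if k = i then p $$ (a, j) else 0)" if "a < m" "k < m" for a k
  proof -
    have "(p * Q) $$ (a, k) = (\<Sum>l\<in>{0..<m}. if l = j then (if k = i then p $$ (a, j) else 0) else 0)"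
    proof -
      have "(p * Q) $$ (a, k) = (\<Sum>l\<in>{0..<m}. p $$ (a, l) * (if l = j \<and> k = i then 1 else 0))"
        using p that by (simp add: Q_def scalar_prod_def)
      also have "\<dots> = (\<Sum>l\<in>{0..<m}. if l = j then (if k = i then p $$ (a, j) else 0) else 0)"
        by (intro sum.cong) auto
      finally show ?thesis .
    qed
    then show ?thesis using ij by simp
  qed
  have prod: "p $$ (a, j) * p $$ (i, b) = c * p $$ (a, b)" if "a < m" "b < m" for a b
  proof -
    have "(p * Q * p) $$ (a, b) = (\<Sum>k\<in>{0..<m}. (p * Q) $$ (a, k) * p $$ (k, b))"
      using p Q that by (simp add: scalar_prod_def del: assoc_mult_mat)
    also have "\<dots> = (\<Sum>k\<in>{0..<m}. if k = i then p $$ (a, j) * p $$ (i, b) else 0)"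
      using that by (intro sum.cong) (auto simp: pQ)
    also have "\<dots> = p $$ (a, j) * p $$ (i, b)" using ij by simp
    finally show ?thesis using c p that by simp
  qed
  have "c = p $$ (i, j)" using prod[of i j] ij by simp
  \<comment> \<open>Dividing the row by the chosen entry turns position (i, j) of
    \<open>p * p = p\<close> into the normalisation.\<close>
  show ?thesis
  proof (rule that[of "\<lambda>a. p $$ (a, j)" "\<lambda>b. p $$ (i, b) / p $$ (i, j)"])
    show "p $$ (a, b) = p $$ (a, j) * (p $$ (i, b) / p $$ (i, j))" if "a < m" "b < m" for a b
      using prod[OF that] \<open>c = _\<close> ij by (simp add: field_simps)
    have "(\<Sum>k<m. p $$ (i, k) * p $$ (k, j)) = (p * p) $$ (i, j)"
      using p ij by (simp add: scalar_prod_def atLeast0LessThan)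
    then have "(\<Sum>k<m. p $$ (i, k) * p $$ (k, j)) = p $$ (i, j)" by (simp add: idem)
    then have "(\<Sum>k<m. p $$ (i, k) * p $$ (k, j)) / p $$ (i, j) = 1" using ij by simp
    then show "(\<Sum>k<m. p $$ (i, k) / p $$ (i, j) * p $$ (k, j)) = 1"
      by (simp add: sum_divide_distrib)
  qed
qed

section \<open>The given isomorphism and the image of the vertex idempotent\<close>

lemma direct_sum_full_matrix_simps:
  "carrier (direct_sum_algebra I (\<lambda>i. full_matrix_algebra (n i))) = (\<Pi>\<^sub>E i\<in>I. carrier_mat (n i) (n i))"
  "x \<otimes>\<^bsub>direct_sum_algebra I (\<lambda>i. full_matrix_algebra (n i))\<^esub> y = (\<lambda>i\<in>I. x i * y i)"
  "x \<oplus>\<^bsub>direct_sum_algebra I (\<lambda>i. full_matrix_algebra (n i))\<^esub> y = (\<lambda>i\<in>I. x i + y i)"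
  "\<one>\<^bsub>direct_sum_algebra I (\<lambda>i. full_matrix_algebra (n i))\<^esub> = (\<lambda>i\<in>I. 1\<^sub>m (n i))"
  "c \<odot>\<^bsub>direct_sum_algebra I (\<lambda>i. full_matrix_algebra (n i))\<^esub> x = (\<lambda>i\<in>I. c \<cdot>\<^sub>m x i)"
  by (simp_all add: direct_sum_algebra_def module_mat_simps)

locale vertex_extension_algebra = vertex_extension X' x0 x1
  for X' :: "'a set" and x0 x1 :: 'a +
  fixes S :: "('a \<Rightarrow> 'a \<Rightarrow> complex) set" and r :: nat and n :: "nat \<Rightarrow> nat"
    and \<phi> :: "('a \<Rightarrow> 'a \<Rightarrow> complex) \<Rightarrow> nat \<Rightarrow> complex mat"
  assumes S: "unital_subalgebra (matrix_algebra_on X') S" and e_S: "diag_idem {x1} \<in> S"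
    and iso: "\<phi> \<in> algebra_iso ((matrix_algebra_on X')\<lparr>carrier := S\<rparr>)
      (direct_sum_algebra {0..r} (\<lambda>i. full_matrix_algebra (n i)))"
    and phi_e_summand: "\<phi> (diag_idem {x1}) \<in> summand {0..r} (\<lambda>i. full_matrix_algebra (n i)) 0"
begin

lemmas S_closed = unital_subalgebraD[OF S, unfolded matrix_algebra_on_simps]
  unital_subalgebra_zero[OF S]

lemma phi_carrier: "M \<in> S \<Longrightarrow> \<phi> M \<in> (\<Pi>\<^sub>E i\<in>{0..r}. carrier_mat (n i) (n i))"
  using iso by (auto simp: algebra_iso_def ring_iso_def Ring.ring_hom_def direct_sum_full_matrix_simps)

lemma phi_mat: "M \<in> S \<Longrightarrow> i \<le> r \<Longrightarrow> \<phi> M i \<in> carrier_mat (n i) (n i)"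
  using phi_carrier[of M] by (auto simp: PiE_def Pi_def)

lemma phi_mult: "M \<in> S \<Longrightarrow> N \<in> S \<Longrightarrow> i \<le> r \<Longrightarrow> \<phi> (M \<odot>' N) i = \<phi> M i * \<phi> N i"
  using iso by (auto simp: algebra_iso_def ring_iso_def Ring.ring_hom_def direct_sum_full_matrix_simps
      matrix_algebra_on_simps)

lemma phi_add: "M \<in> S \<Longrightarrow> N \<in> S \<Longrightarrow> i \<le> r \<Longrightarrow> \<phi> (\<lambda>x y. M x y + N x y) i = \<phi> M i + \<phi> N i"
  using iso by (auto simp: algebra_iso_def ring_iso_def Ring.ring_hom_def direct_sum_full_matrix_simps
      matrix_algebra_on_simps)

lemma phi_smult: "M \<in> S \<Longrightarrow> i \<le> r \<Longrightarrow> \<phi> (\<lambda>x y. c * M x y) i = c \<cdot>\<^sub>m \<phi> M i"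
  using iso by (auto simp: algebra_iso_def ring_iso_def Ring.ring_hom_def direct_sum_full_matrix_simps
      matrix_algebra_on_simps)

lemma phi_one: "i \<le> r \<Longrightarrow> \<phi> (diag_idem X') i = 1\<^sub>m (n i)"
  using iso by (auto simp: algebra_iso_def ring_iso_def Ring.ring_hom_def direct_sum_full_matrix_simps
      matrix_algebra_on_simps)

lemma phi_zero: "i \<le> r \<Longrightarrow> \<phi> (\<lambda>x y. 0) i = 0\<^sub>m (n i) (n i)"
proof -
  assume i: "i \<le> r"
  have eq: "\<phi> (\<lambda>x y. 0) i = 0 \<cdot>\<^sub>m \<phi> (\<lambda>x y. 0) i"
    using phi_smult[OF S_closed(6) i, of 0] by simp
  show ?thesis
    using phi_mat[OF S_closed(6) i] by (subst eq) (intro eq_matI; simp)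
qed

lemma phi_bij: "bij_betw \<phi> S (\<Pi>\<^sub>E i\<in>{0..r}. carrier_mat (n i) (n i))"
  using iso by (simp add: algebra_iso_def ring_iso_def direct_sum_full_matrix_simps)

lemma phi_surj:
  assumes "\<And>i. i \<le> r \<Longrightarrow> Q i \<in> carrier_mat (n i) (n i)"
  obtains M where "M \<in> S" and "\<And>i. i \<le> r \<Longrightarrow> \<phi> M i = Q i"
proof -
  have "restrict Q {0..r} \<in> \<phi> ` S"
    using assms bij_betw_imp_surj_on[OF phi_bij] by (auto simp: PiE_def)
  then obtain M where "M \<in> S" "restrict Q {0..r} = \<phi> M" by auto
  moreover have "\<phi> M i = Q i" if "i \<le> r" for i
    using fun_cong[OF \<open>restrict Q {0..r} = \<phi> M\<close>, of i] that by simp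
  ultimately show ?thesis using that by blast
qed

lemma phi_eqI:
  assumes "M \<in> S" and "N \<in> S" and "\<And>i. i \<le> r \<Longrightarrow> \<phi> M i = \<phi> N i"
  shows "M = N"
proof -
  have "\<phi> M = \<phi> N"
    using assms by (intro PiE_ext[OF phi_carrier phi_carrier]) auto
  then show ?thesis
    using assms(1,2) phi_bij by (auto simp: bij_betw_def inj_on_def)
qed

lemma phi_e: "i \<le> r \<Longrightarrow> i \<noteq> 0 \<Longrightarrow> \<phi> (diag_idem {x1}) i = 0\<^sub>m (n i) (n i)"
  using phi_e_summand by (simp add: summand_def module_mat_simps)

lemma e_mult_mult_e: "diag_idem {x1} \<odot>' (M \<odot>' diag_idem {x1}) = (\<lambda>x y. M x1 x1 * diag_idem {x1} x y)"
  unfolding sum_diag_idem[OF finite_X'] using x1_X' by (auto simp: diag_idem_def fun_eq_iff)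

lemma e_idem: "diag_idem {x1} \<odot>' diag_idem {x1} = (diag_idem {x1} :: 'a \<Rightarrow> 'a \<Rightarrow> complex)"
  unfolding sum_diag_idem[OF finite_X'] using x1_X' by (auto simp: diag_idem_def fun_eq_iff)

text \<open>Every \<open>Q\<close> is the component at 0 of some \<open>\<phi> M\<close>, and
  \<open>e_mult_mult_e\<close> then makes p Q p a multiple of p. Injectivity of
  \<open>\<phi>\<close> excludes p = 0, as all other components of the idempotent vanish.\<close>

lemma phi_e_rank_one:
  obtains u v where "\<And>a b. a < n 0 \<Longrightarrow> b < n 0 \<Longrightarrow> \<phi> (diag_idem {x1}) 0 $$ (a, b) = u a * v b"
    and "(\<Sum>k<n 0. v k * u k) = 1"
proof (rule rank_one_idempotent)
  let ?p = "\<phi> (diag_idem {x1}) 0"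
  show p: "?p \<in> carrier_mat (n 0) (n 0)" using e_S by (simp add: phi_mat)
  show "?p * ?p = ?p"
    using phi_mult[OF e_S e_S, of 0] by (simp add: e_idem)
  show "?p \<noteq> 0\<^sub>m (n 0) (n 0)"
  proof
    assume 0: "?p = 0\<^sub>m (n 0) (n 0)"
    have "diag_idem {x1} = (\<lambda>x y. 0 :: complex)"
    proof (rule phi_eqI[OF e_S S_closed(6)])
      fix i assume "i \<le> r"
      then show "\<phi> (diag_idem {x1}) i = \<phi> (\<lambda>x y. 0) i"
        using 0 by (cases "i = 0") (simp_all add: phi_e phi_zero)
    qed
    from fun_cong[OF fun_cong[OF this], of x1 x1] show False by (simp add: diag_idem_def)
  qed
  show "\<exists>c. ?p * Q * ?p = c \<cdot>\<^sub>m ?p" if Q: "Q \<in> carrier_mat (n 0) (n 0)" for Q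
  proof -
    obtain M where M: "M \<in> S" "\<And>i. i \<le> r \<Longrightarrow> \<phi> M i = (if i = 0 then Q else 0\<^sub>m (n i) (n i))"
      by (rule phi_surj[of "\<lambda>i. if i = 0 then Q else 0\<^sub>m (n i) (n i)"]) (simp add: Q, blast)
    have "?p * Q * ?p = ?p * (Q * ?p)" using p Q by simp
    also have "\<dots> = \<phi> (diag_idem {x1} \<odot>' (M \<odot>' diag_idem {x1})) 0"
      using M e_S S_closed(4)[OF M(1) e_S] by (simp add: phi_mult)
    also have "\<dots> = M x1 x1 \<cdot>\<^sub>m ?p"
      unfolding e_mult_mult_e using e_S by (simp add: phi_smult)
    finally show ?thesis ..
  qed
qed (use that in blast)

end

text \<open>The rank-one factors become parameters because border coordinates are measured in them.
  Scaling \<open>u\<close> by c and \<open>v\<close> by 1/c respects both assumptions and merely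
  conjugates the new block by a diagonal matrix.\<close>

locale vertex_extension_iso = vertex_extension_algebra X' x0 x1 S r n \<phi>
  for X' :: "'a set" and x0 x1 :: 'a and S r n \<phi> +
  fixes u v :: "nat \<Rightarrow> complex"
  assumes phi_e_uv: "\<And>a b. a < n 0 \<Longrightarrow> b < n 0 \<Longrightarrow> \<phi> (diag_idem {x1}) 0 $$ (a, b) = u a * v b"
    and uv_one: "(\<Sum>k<n 0. v k * u k) = 1"
begin

section \<open>Border coordinates in the summand of index 0\<close>

definition entry :: "('a \<Rightarrow> 'a \<Rightarrow> complex) \<Rightarrow> nat \<Rightarrow> nat \<Rightarrow> complex" where
  "entry M a b = \<phi> M 0 $$ (a, b)"

lemma entry_mult:
  assumes "M \<in> S" and "N \<in> S" and "a < n 0" and "b < n 0"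
  shows "entry (M \<odot>' N) a b = (\<Sum>k<n 0. entry M a k * entry N k b)"
  using assms phi_mat[of M 0] phi_mat[of N 0] phi_mult[of M N 0]
  by (simp add: entry_def scalar_prod_def atLeast0LessThan)

lemma entry_add:
  assumes "M \<in> S" and "N \<in> S" and "a < n 0" and "b < n 0"
  shows "entry (\<lambda>x y. M x y + N x y) a b = entry M a b + entry N a b"
  using assms phi_mat[of M 0] phi_mat[of N 0] phi_add[of M N 0] by (simp add: entry_def)

lemma entry_smult:
  assumes "M \<in> S" and "a < n 0" and "b < n 0"
  shows "entry (\<lambda>x y. c * M x y) a b = c * entry M a b"
  using assms phi_mat[of M 0] phi_smult[of M 0] by (simp add: entry_def)

lemma entry_zero: "a < n 0 \<Longrightarrow> b < n 0 \<Longrightarrow> entry (\<lambda>x y. 0) a b = 0"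
  by (simp add: entry_def phi_zero)

lemma entry_e: "a < n 0 \<Longrightarrow> b < n 0 \<Longrightarrow> entry (diag_idem {x1}) a b = u a * v b"
  by (simp add: entry_def phi_e_uv)

lemma sum_uv: "(\<Sum>k<n 0. c * v k * (u k * d)) = c * d" "(\<Sum>k<n 0. c * v k * u k) = c"
  "(\<Sum>k<n 0. v k * (u k * c)) = c"
proof -
  have "(\<Sum>k<n 0. c * v k * (u k * d)) = c * d * (\<Sum>k<n 0. v k * u k)" for c d
    by (simp add: sum_distrib_left algebra_simps)
  then show *: "(\<Sum>k<n 0. c * v k * (u k * d)) = c * d" for c d by (simp add: uv_one)
  show "(\<Sum>k<n 0. c * v k * u k) = c" using *[of c 1] by simp
  show "(\<Sum>k<n 0. v k * (u k * c)) = c" using *[of 1 c] by simp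
qed

text \<open>For \<open>M\<close> in \<open>extend S\<close>, the image of the shifted column is w
  v^T, and contracting with \<open>u\<close> returns w because v . u = 1. Dually,
  \<open>row_coeff\<close> contracts u w^T with \<open>v\<close>.\<close>

definition col_coeff :: "('a \<Rightarrow> 'a \<Rightarrow> complex) \<Rightarrow> nat \<Rightarrow> complex" where
  "col_coeff M a = (\<Sum>k<n 0. entry (col0 M) a k * u k)"

definition row_coeff :: "('a \<Rightarrow> 'a \<Rightarrow> complex) \<Rightarrow> nat \<Rightarrow> complex" where
  "row_coeff M b = (\<Sum>k<n 0. v k * entry (row0 M) k b)"

lemma extendD:
  assumes "M \<in> extend S"
  shows "restr M \<in> S" "col0 M \<in> S" "row0 M \<in> S"
  using assms by (auto simp: extend_def)

lemma entry_col0: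
  assumes "M \<in> extend S" and "a < n 0" and "b < n 0"
  shows "entry (col0 M) a b = col_coeff M a * v b"
proof -
  have "entry (col0 M) a b = entry (col0 M \<odot>' diag_idem {x1}) a b" by (simp only: col0_mult_e)
  also have "\<dots> = (\<Sum>k<n 0. entry (col0 M) a k * (u k * v b))"
    using assms e_S extendD(2)[OF assms(1)] by (simp add: entry_mult entry_e)
  finally show ?thesis by (simp add: col_coeff_def sum_distrib_right mult.assoc)
qed

lemma entry_row0:
  assumes "M \<in> extend S" and "a < n 0" and "b < n 0"
  shows "entry (row0 M) a b = u a * row_coeff M b"
proof -
  have "entry (row0 M) a b = entry (diag_idem {x1} \<odot>' row0 M) a b" by (simp only: e_mult_row0)
  also have "\<dots> = (\<Sum>k<n 0. u a * v k * entry (row0 M) k b)"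
    using assms e_S extendD(3)[OF assms(1)] by (simp add: entry_mult entry_e)
  finally show ?thesis by (simp add: row_coeff_def sum_distrib_left mult.assoc)
qed

lemma col_coeffI: "(\<And>b. b < n 0 \<Longrightarrow> entry (col0 M) a b = c * v b) \<Longrightarrow> col_coeff M a = c"
  by (simp add: col_coeff_def sum_uv)

lemma row_coeffI: "(\<And>a. a < n 0 \<Longrightarrow> entry (row0 M) a b = u a * c) \<Longrightarrow> row_coeff M b = c"
  by (simp add: row_coeff_def sum_uv)

text \<open>The summand assumption on the vertex idempotent takes effect here: away from index 0 its
  image vanishes, hence so do the borders, and these blocks keep their size.\<close>

lemma phi_col0: "M \<in> extend S \<Longrightarrow> i \<le> r \<Longrightarrow> i \<noteq> 0 \<Longrightarrow> \<phi> (col0 M) i = 0\<^sub>m (n i) (n i)"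
  using phi_mult[OF extendD(2) e_S, of M i] phi_mat[OF extendD(2), of M i]
  by (simp add: col0_mult_e phi_e)

lemma phi_row0: "M \<in> extend S \<Longrightarrow> i \<le> r \<Longrightarrow> i \<noteq> 0 \<Longrightarrow> \<phi> (row0 M) i = 0\<^sub>m (n i) (n i)"
  using phi_mult[OF e_S extendD(3), of M i] phi_mat[OF extendD(3), of M i]
  by (simp add: e_mult_row0 phi_e)

text \<open>Index \<open>n 0\<close>, the last one of the enlarged block, stands for the vertex
  \<open>x0\<close>.\<close>

definition block :: "('a \<Rightarrow> 'a \<Rightarrow> complex) \<Rightarrow> nat \<Rightarrow> nat \<Rightarrow> complex" where
  "block M a b =
    (if a < n 0 then if b < n 0 then entry (restr M) a b else col_coeff M a
     else if b < n 0 then row_coeff M b else M x0 x0)"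

definition \<psi> :: "('a \<Rightarrow> 'a \<Rightarrow> complex) \<Rightarrow> nat \<Rightarrow> complex mat" where
  "\<psi> M = (\<lambda>i\<in>{0..r}. if i = 0 then mat (n 0 + 1) (n 0 + 1) (\<lambda>(a, b). block M a b)
     else \<phi> (restr M) i)"

text \<open>The corner scalars are compared through the product of \<open>row0 M\<close> and
  \<open>col0 N\<close>, whose image is a multiple of u v^T that can be computed in two
  ways.\<close>

lemma corner_mult:
  assumes M: "M \<in> extend S" and N: "N \<in> extend S"
  shows "(M \<odot>0 N) x0 x0 = (\<Sum>k<n 0. row_coeff M k * col_coeff N k) + M x0 x0 * N x0 x0"
proof -
  \<comment> \<open>The diagonal entries of u v^T sum to 1, so one of them is nonzero and can be
    cancelled.\<close>
  obtain a where a: "a < n 0" "u a * v a \<noteq> 0"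
    using uv_one by (metis (no_types, lifting) lessThan_iff mult.commute sum.neutral zero_neq_one)
  have "entry (row0 M \<odot>' col0 N) a a = (\<Sum>k<n 0. u a * row_coeff M k * (col_coeff N k * v a))"
    using M N a extendD[OF M] extendD[OF N] by (simp add: entry_mult entry_row0 entry_col0)
  moreover have "entry (row0 M \<odot>' col0 N) a a = ((M \<odot>0 N) x0 x0 - M x0 x0 * N x0 x0) * (u a * v a)"
    unfolding row0_col0_mult using a by (simp only: entry_smult[OF e_S] entry_e)
  moreover have "(\<Sum>k<n 0. u a * row_coeff M k * (col_coeff N k * v a)) =
      (\<Sum>k<n 0. row_coeff M k * col_coeff N k) * (u a * v a)"
    by (simp add: sum_distrib_right sum_distrib_left algebra_simps)
  ultimately have "(\<Sum>k<n 0. row_coeff M k * col_coeff N k) * (u a * v a) =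
      ((M \<odot>0 N) x0 x0 - M x0 x0 * N x0 x0) * (u a * v a)" by (simp only:)
  then have "(\<Sum>k<n 0. row_coeff M k * col_coeff N k) = (M \<odot>0 N) x0 x0 - M x0 x0 * N x0 x0"
    using a(2) by (simp only: mult_cancel_right) blast
  then show ?thesis by (simp only: diff_add_cancel)
qed

lemma block_mult:
  assumes M: "M \<in> extend S" and N: "N \<in> extend S" and "a < n 0 + 1" and "b < n 0 + 1"
  shows "block (M \<odot>0 N) a b = (\<Sum>k<n 0 + 1. block M a k * block N k b)"
proof -
  note ex = extendD[OF M] extendD[OF N]
  have split: "(\<Sum>k<n 0 + 1. block M a k * block N k b) =
      (\<Sum>k<n 0. block M a k * block N k b) + block M a (n 0) * block N (n 0) b"
    by simp
  consider (ul) "a < n 0" "b < n 0" | (ur) "a < n 0" "b = n 0" | (ll) "a = n 0" "b < n 0"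
    | (lr) "a = n 0" "b = n 0"
    using assms by linarith
  then show ?thesis
  proof cases
    case ul
    have "entry (restr (M \<odot>0 N)) a b =
        entry (restr M \<odot>' restr N) a b + entry (col0 M \<odot>' row0 N) a b"
      unfolding restr_mult using ex ul by (intro entry_add S_closed(4))
    \<comment> \<open>By v . u = 1 the product of the two rank-one borders collapses to a single
      term.\<close>
    also have "\<dots> = (\<Sum>k<n 0. entry (restr M) a k * entry (restr N) k b) + col_coeff M a * row_coeff N b"
      using ex ul M N by (simp add: entry_mult entry_col0 entry_row0 sum_uv)
    finally show ?thesis unfolding split using ul by (simp add: block_def)
  next
    case ur
    have "col_coeff (M \<odot>0 N) a =
        (\<Sum>k<n 0. entry (restr M) a k * col_coeff N k) + N x0 x0 * col_coeff M a"
    proof (rule col_coeffI)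
      fix b assume b: "b < n 0"
      have "entry (col0 (M \<odot>0 N)) a b =
          entry (restr M \<odot>' col0 N) a b + entry (\<lambda>x y. N x0 x0 * col0 M x y) a b"
        unfolding col0_mult using ex ur b by (intro entry_add S_closed(4,5))
      then show "entry (col0 (M \<odot>0 N)) a b =
          ((\<Sum>k<n 0. entry (restr M) a k * col_coeff N k) + N x0 x0 * col_coeff M a) * v b"
        using ex ur b M N
        by (simp add: entry_mult entry_smult entry_col0 sum_distrib_right distrib_right mult.assoc)
    qed
    then show ?thesis unfolding split using ur by (simp add: block_def)
  next
    case ll
    have "row_coeff (M \<odot>0 N) b =
        (\<Sum>k<n 0. row_coeff M k * entry (restr N) k b) + M x0 x0 * row_coeff N b"
    proof (rule row_coeffI)
      fix a assume a: "a < n 0"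
      have "entry (row0 (M \<odot>0 N)) a b =
          entry (row0 M \<odot>' restr N) a b + entry (\<lambda>x y. M x0 x0 * row0 N x y) a b"
        unfolding row0_mult using ex ll a by (intro entry_add S_closed(4,5))
      then show "entry (row0 (M \<odot>0 N)) a b =
          u a * ((\<Sum>k<n 0. row_coeff M k * entry (restr N) k b) + M x0 x0 * row_coeff N b)"
        using ex ll a M N
        by (simp add: entry_mult entry_smult entry_row0 sum_distrib_left distrib_left mult.assoc
            mult.left_commute[of _ "u a"])
    qed
    then show ?thesis unfolding split using ll by (simp add: block_def)
  next
    case lr
    then show ?thesis unfolding split using corner_mult[OF M N] by (simp add: block_def)
  qed
qed

lemma block_add:
  assumes M: "M \<in> extend S" and N: "N \<in> extend S"
  shows "block (\<lambda>x y. M x y + N x y) a b = block M a b + block N a b"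
  using extendD[OF M] extendD[OF N]
  by (simp add: block_def col_coeff_def row_coeff_def blocks_add entry_add sum.distrib algebra_simps)

lemma block_smult:
  assumes M: "M \<in> extend S"
  shows "block (\<lambda>x y. c * M x y) a b = c * block M a b"
  using extendD[OF M]
  by (simp add: block_def col_coeff_def row_coeff_def blocks_smult entry_smult sum_distrib_left
      algebra_simps)

section \<open>The bordered map is a homomorphism\<close>

lemma psi_mat:
  "M \<in> extend S \<Longrightarrow> i \<le> r \<Longrightarrow> \<psi> M i \<in> carrier_mat ((n(0 := n 0 + 1)) i) ((n(0 := n 0 + 1)) i)"
  using phi_mat[OF extendD(1)] by (simp add: \<psi>_def)

lemma psi_hom:
  assumes M: "M \<in> extend S" and N: "N \<in> extend S"
  shows "\<psi> (M \<odot>0 N) = (\<lambda>i\<in>{0..r}. \<psi> M i * \<psi> N i)"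
    and "\<psi> (\<lambda>x y. M x y + N x y) = (\<lambda>i\<in>{0..r}. \<psi> M i + \<psi> N i)"
    and "\<psi> (\<lambda>x y. c * M x y) = (\<lambda>i\<in>{0..r}. c \<cdot>\<^sub>m \<psi> M i)"
proof -
  note ex = extendD[OF M] extendD[OF N]
  show "\<psi> (M \<odot>0 N) = (\<lambda>i\<in>{0..r}. \<psi> M i * \<psi> N i)"
  proof
    fix i
    consider "i > r" | "i = 0" | "i \<le> r" "i \<noteq> 0" by linarith
    then show "\<psi> (M \<odot>0 N) i = (\<lambda>i\<in>{0..r}. \<psi> M i * \<psi> N i) i"
    proof cases
      case 2
      have "block (M \<odot>0 N) a b = (\<Sum>k = 0..<Suc (n 0). block M a k * block N k b)"
        if "a < Suc (n 0)" "b < Suc (n 0)" for a b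
        using block_mult[OF M N, of a b] that by (simp add: atLeast0LessThan)
      then show ?thesis
        using 2 by (auto simp: \<psi>_def scalar_prod_def simp del: sum.insert intro!: eq_matI)
    next
      case 3
      \<comment> \<open>Restriction is not multiplicative on \<open>extend S\<close>, but for
        indices other than 0 the cross term through \<open>x0\<close> disappears under
        \<open>\<phi>\<close>.\<close>
      have "\<phi> (restr (M \<odot>0 N)) i = \<phi> (restr M \<odot>' restr N) i + \<phi> (col0 M \<odot>' row0 N) i"
        unfolding restr_mult using ex 3 by (intro phi_add S_closed(4))
      also have "\<dots> = \<phi> (restr M) i * \<phi> (restr N) i"
        using ex 3 phi_mat[OF ex(1), of i] phi_mat[OF ex(4), of i]
        by (simp add: phi_mult phi_col0[OF M] phi_row0[OF N])
      finally show ?thesis using 3 by (simp add: \<psi>_def)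
    qed (simp add: \<psi>_def)
  qed
  show "\<psi> (\<lambda>x y. M x y + N x y) = (\<lambda>i\<in>{0..r}. \<psi> M i + \<psi> N i)"
    using ex by (auto simp: \<psi>_def fun_eq_iff block_add[OF M N] blocks_add phi_add intro!: eq_matI)
  show "\<psi> (\<lambda>x y. c * M x y) = (\<lambda>i\<in>{0..r}. c \<cdot>\<^sub>m \<psi> M i)"
    using ex by (auto simp: \<psi>_def fun_eq_iff block_smult[OF M] blocks_smult phi_smult intro!: eq_matI)
qed

lemma psi_one: "\<psi> (diag_idem (insert x0 X')) = (\<lambda>i\<in>{0..r}. 1\<^sub>m ((n(0 := n 0 + 1)) i))"
proof -
  have "insert x0 X' - {x0} = X'" using x0_notin by auto
  then have blocks: "restr (diag_idem (insert x0 X')) = diag_idem X'"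
    "col0 (diag_idem (insert x0 X')) = (\<lambda>x y. 0)" "row0 (diag_idem (insert x0 X')) = (\<lambda>x y. 0)"
    by (simp_all add: blocks_diag_idem)
  have "block (diag_idem (insert x0 X')) a b = (if a = b then 1 else 0)"
    if "a < Suc (n 0)" "b < Suc (n 0)" for a b
    using that
    by (auto simp: block_def blocks col_coeff_def row_coeff_def entry_zero entry_def phi_one phi_zero
        diag_idem_def[of _ x0 x0])
  then show ?thesis
    by (auto simp: \<psi>_def fun_eq_iff blocks phi_one intro!: eq_matI)
qed

section \<open>Injectivity and surjectivity of the bordered map\<close>

lemma eq_from_blocks:
  assumes "M \<in> extend S" and "N \<in> extend S" and "restr M = restr N" and "col0 M = col0 N"
    and "row0 M = row0 N" and "M x0 x0 = N x0 x0"
  shows "M = N"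
proof -
  have "M \<in> carrier (matrix_algebra_on (insert x0 X'))" "N \<in> carrier (matrix_algebra_on (insert x0 X'))"
    using assms(1,2) by (simp_all add: extend_def)
  from trans[OF extend_decomposition[OF this(1), unfolded assms(3-6)] extend_decomposition[OF this(2), symmetric]]
  show ?thesis .
qed

lemma eq_from_entries:
  assumes M: "M \<in> S" and N: "N \<in> S"
    and "\<And>i. i \<le> r \<Longrightarrow> i \<noteq> 0 \<Longrightarrow> \<phi> M i = \<phi> N i"
    and entries: "\<And>a b. a < n 0 \<Longrightarrow> b < n 0 \<Longrightarrow> entry M a b = entry N a b"
  shows "M = N"
proof (rule phi_eqI[OF M N])
  fix i assume i: "i \<le> r"
  show "\<phi> M i = \<phi> N i"
  proof (cases "i = 0")
    case True
    then show ?thesis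
      using entries phi_mat[OF M i] phi_mat[OF N i] by (intro eq_matI) (auto simp: entry_def)
  qed (use assms(3) i in simp)
qed

lemma psi_inj: "inj_on \<psi> (extend S)"
proof (rule inj_onI)
  fix M N assume M: "M \<in> extend S" and N: "N \<in> extend S" and eq: "\<psi> M = \<psi> N"
  note ex = extendD[OF M] extendD[OF N]
  have block: "block M a b = block N a b" if "a < Suc (n 0)" "b < Suc (n 0)" for a b
    using arg_cong[OF fun_cong[OF eq, of 0], of "\<lambda>A. A $$ (a, b)"] that by (simp add: \<psi>_def)
  have col: "col_coeff M a = col_coeff N a" if "a < n 0" for a
    using block[of a "n 0"] that by (simp add: block_def)
  have row: "row_coeff M b = row_coeff N b" if "b < n 0" for b
    using block[of "n 0" b] that by (simp add: block_def)
  have "restr M = restr N"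
  proof (rule eq_from_entries[OF ex(1,4)])
    show "\<phi> (restr M) i = \<phi> (restr N) i" if "i \<le> r" "i \<noteq> 0" for i
      using fun_cong[OF eq, of i] that by (simp add: \<psi>_def)
    show "entry (restr M) a b = entry (restr N) a b" if "a < n 0" "b < n 0" for a b
      using block[of a b] that by (simp add: block_def)
  qed
  moreover have "col0 M = col0 N"
    using col by (intro eq_from_entries[OF ex(2,5)]) (simp_all add: phi_col0 M N entry_col0)
  moreover have "row0 M = row0 N"
    using row by (intro eq_from_entries[OF ex(3,6)]) (simp_all add: phi_row0 M N entry_row0)
  moreover have "M x0 x0 = N x0 x0"
    using block[of "n 0" "n 0"] by (simp add: block_def)
  ultimately show "M = N" by (rule eq_from_blocks[OF M N])
qed

lemma phi_surj0:
  assumes "\<And>i. i \<le> r \<Longrightarrow> i \<noteq> 0 \<Longrightarrow> Q i \<in> carrier_mat (n i) (n i)"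
  obtains M where "M \<in> S" and "\<And>i. i \<le> r \<Longrightarrow> i \<noteq> 0 \<Longrightarrow> \<phi> M i = Q i"
    and "\<And>a b. a < n 0 \<Longrightarrow> b < n 0 \<Longrightarrow> entry M a b = f a b"
proof -
  obtain M where "M \<in> S" "\<And>i. i \<le> r \<Longrightarrow> \<phi> M i = (if i = 0 then mat (n 0) (n 0) (\<lambda>(a, b). f a b) else Q i)"
    by (rule phi_surj[of "\<lambda>i. if i = 0 then mat (n 0) (n 0) (\<lambda>(a, b). f a b) else Q i"])
      (simp add: assms, blast)
  then show ?thesis by (intro that[of M]) (simp_all add: entry_def)
qed

lemma psi_surj:
  assumes Q: "Q \<in> (\<Pi>\<^sub>E i\<in>{0..r}. carrier_mat ((n(0 := n 0 + 1)) i) ((n(0 := n 0 + 1)) i))"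
  shows "Q \<in> \<psi> ` extend S"
proof -
  have Q_mat: "Q i \<in> carrier_mat ((n(0 := n 0 + 1)) i) ((n(0 := n 0 + 1)) i)" if "i \<le> r" for i
    using Q that by (simp add: PiE_def Pi_def)
  have Q_mat': "Q i \<in> carrier_mat (n i) (n i)" if "i \<le> r" "i \<noteq> 0" for i
    using Q_mat[of i] that by simp
  let ?m = "n 0"
  obtain R where R: "R \<in> S" "\<And>i. i \<le> r \<Longrightarrow> i \<noteq> 0 \<Longrightarrow> \<phi> R i = Q i"
    "\<And>a b. a < ?m \<Longrightarrow> b < ?m \<Longrightarrow> entry R a b = Q 0 $$ (a, b)"
    using phi_surj0[of Q "\<lambda>a b. Q 0 $$ (a, b)"] Q_mat' by blast
  \<comment> \<open>The prescribed border column w and border row z enter \<open>S\<close> as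
    preimages of the rank-one matrices w v^T and u z^T.\<close>
  obtain C where C: "C \<in> S" "\<And>i. i \<le> r \<Longrightarrow> i \<noteq> 0 \<Longrightarrow> \<phi> C i = 0\<^sub>m (n i) (n i)"
    "\<And>a b. a < ?m \<Longrightarrow> b < ?m \<Longrightarrow> entry C a b = Q 0 $$ (a, ?m) * v b"
    using phi_surj0[of "\<lambda>i. 0\<^sub>m (n i) (n i)" "\<lambda>a b. Q 0 $$ (a, ?m) * v b"] by auto
  obtain W where W: "W \<in> S" "\<And>i. i \<le> r \<Longrightarrow> i \<noteq> 0 \<Longrightarrow> \<phi> W i = 0\<^sub>m (n i) (n i)"
    "\<And>a b. a < ?m \<Longrightarrow> b < ?m \<Longrightarrow> entry W a b = u a * Q 0 $$ (?m, b)"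
    using phi_surj0[of "\<lambda>i. 0\<^sub>m (n i) (n i)" "\<lambda>a b. u a * Q 0 $$ (?m, b)"] by auto
  \<comment> \<open>As v . u = 1, right multiplication by u v^T fixes the image of \<open>C\<close>.
    Injectivity carries this back to \<open>S\<close>: the matrix \<open>C\<close> lives in the
    column of \<open>x1\<close>, so it is a shifted column.\<close>
  have "C \<odot>' diag_idem {x1} = C"
    using C e_S
    by (intro eq_from_entries S_closed(4))
      (simp_all add: phi_mult phi_e entry_mult entry_e sum_uv)
  then have C_x1: "C x y = (if y = x1 then C x x1 else 0)" for x y
    unfolding sum_diag_idem[OF finite_X'] fun_eq_iff using x1_X' by (metis singletonD)
  have "diag_idem {x1} \<odot>' W = W"
  proof (intro eq_from_entries S_closed(4) W(1) e_S)
    show "entry (diag_idem {x1} \<odot>' W) a b = entry W a b" if "a < ?m" "b < ?m" for a b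
      using W e_S that sum_uv(1)[of "u a" "Q 0 $$ (?m, b)"] by (simp add: entry_mult entry_e)
  qed (use W e_S in \<open>simp_all add: phi_mult phi_e\<close>)
  then have W_x1: "W x y = (if x = x1 then W x1 y else 0)" for x y
    unfolding sum_diag_idem[OF finite_X'] fun_eq_iff using x1_X' by (metis singletonD)
  have supp: "T x y = 0" if "T \<in> S" "x \<notin> X' \<or> y \<notin> X'" for T x y
    using that S_closed(1) by (fastforce simp: matrix_algebra_on_carrier)
  \<comment> \<open>This undoes the shifts: the column of \<open>C\<close> and the row of
    \<open>W\<close> at \<open>x1\<close> return to \<open>x0\<close>. The corner entry may be
    prescribed freely in \<open>extend S\<close>.\<close>
  define M where "M = (\<lambda>x y. if x = x0 then if y = x0 then Q 0 $$ (?m, ?m) else W x1 y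
    else if y = x0 then C x x1 else R x y)"
  have restr_M: "restr M = R"
    using supp[OF R(1)] x0_notin by (auto simp: restr_def M_def fun_eq_iff)
  have col_M: "col0 M = C"
  proof (intro ext)
    fix x y show "col0 M x y = C x y"
      using supp[OF C(1), of x x1] x0_notin C_x1[of x y]
      by (cases "x \<in> X'"; cases "y = x1") (auto simp: col0_def M_def)
  qed
  have row_M: "row0 M = W"
  proof (intro ext)
    fix x y show "row0 M x y = W x y"
      using supp[OF W(1), of x1 y] x0_notin W_x1[of x y]
      by (cases "y \<in> X'"; cases "x = x1") (auto simp: row0_def M_def)
  qed
  have "M x y = 0" if "x \<notin> insert x0 X' \<or> y \<notin> insert x0 X'" for x y
    using that supp[OF R(1), of x y] supp[OF C(1), of x x1] supp[OF W(1), of x1 y]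
    by (cases "x = x0"; cases "y = x0") (auto simp: M_def)
  then have "M \<in> carrier (matrix_algebra_on (insert x0 X'))"
    unfolding matrix_algebra_on_carrier by blast
  then have M: "M \<in> extend S"
    using R(1) C(1) W(1) by (simp add: extend_def restr_M col_M row_M)
  have "col_coeff M a = Q 0 $$ (a, ?m)" if "a < ?m" for a
    using C(3) that by (intro col_coeffI) (simp add: col_M)
  moreover have "row_coeff M b = Q 0 $$ (?m, b)" if "b < ?m" for b
    using W(3) that by (intro row_coeffI) (simp add: row_M)
  moreover have "M x0 x0 = Q 0 $$ (?m, ?m)" by (simp add: M_def)
  ultimately have block: "block M a b = Q 0 $$ (a, b)" if "a < Suc ?m" "b < Suc ?m" for a b
    using that R(3) by (auto simp: block_def restr_M less_Suc_eq)
  have "\<psi> M = Q"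
  proof
    fix i
    consider "i > r" | "i = 0" | "i \<le> r" "i \<noteq> 0" by linarith
    then show "\<psi> M i = Q i"
    proof cases
      case 1
      then show ?thesis using Q by (simp add: \<psi>_def PiE_def extensional_def)
    next
      case 2
      then show ?thesis using Q_mat[of 0] block by (intro eq_matI) (auto simp: \<psi>_def)
    next
      case 3
      then show ?thesis using R(2) by (simp add: \<psi>_def restr_M)
    qed
  qed
  then show ?thesis using M by blast
qed

lemma psi_carrier:
  "M \<in> extend S \<Longrightarrow> \<psi> M \<in> (\<Pi>\<^sub>E i\<in>{0..r}. carrier_mat ((n(0 := n 0 + 1)) i) ((n(0 := n 0 + 1)) i))"
  using psi_mat[of M] by (auto simp: \<psi>_def)

lemma psi_bij:
  "bij_betw \<psi> (extend S) (\<Pi>\<^sub>E i\<in>{0..r}. carrier_mat ((n(0 := n 0 + 1)) i) ((n(0 := n 0 + 1)) i))"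
  unfolding bij_betw_def using psi_inj psi_carrier psi_surj by blast

lemma psi_iso:
  "\<psi> \<in> algebra_iso ((matrix_algebra_on (insert x0 X'))\<lparr>carrier := extend S\<rparr>)
    (direct_sum_algebra {0..r} (\<lambda>i. full_matrix_algebra ((n(0 := n 0 + 1)) i)))"
  unfolding algebra_iso_def ring_iso_def Ring.ring_hom_def direct_sum_full_matrix_simps
  using psi_bij psi_carrier psi_hom psi_one
  by (simp add: matrix_algebra_on_simps del: sum.insert fun_upd_apply)

text \<open>Cutting off \<open>x0\<close> annihilates its idempotent, so only the bordered component
  survives.\<close>

lemma psi_vertex_idem:
  "\<psi> (diag_idem {x0}) \<in> summand {0..r} (\<lambda>i. full_matrix_algebra ((n(0 := n 0 + 1)) i)) 0"
proof -
  have empty: "diag_idem {} = (\<lambda>x y. 0)" by (simp add: diag_idem_def fun_eq_iff)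
  have "diag_idem {x0} \<in> extend S"
    using S_closed(6) by (simp add: extend_def blocks_diag_idem diag_idem_carrier empty)
  then have "\<psi> (diag_idem {x0}) \<in> (\<Pi>\<^sub>E i\<in>{0..r}. carrier_mat ((n(0 := n 0 + 1)) i) ((n(0 := n 0 + 1)) i))"
    by (rule psi_carrier)
  moreover have "\<psi> (diag_idem {x0}) i = 0\<^sub>m (n i) (n i)" if "i \<le> r" "i \<noteq> 0" for i
    using that by (simp add: \<psi>_def blocks_diag_idem empty phi_zero)
  ultimately show ?thesis
    unfolding summand_def direct_sum_full_matrix_simps by (simp add: module_mat_simps)
qed

end

section \<open>Application to both Terwilliger algebras\<close>

theorem proposition6p2:
  fixes X X' :: "'a set" and E E' :: "'a set set" and x0 x1 :: 'a
    and l r :: nat and n :: "nat \<Rightarrow> nat"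
  assumes "simple_graph X E" and "connected_graph X E"
    and "x0 \<in> X" and "valency X E x0 = 1"
    and "x1 \<in> X" and "{x0, x1} \<in> E"
    and "X' = X - {x0}" and "E' = E - {{x0, x1}}"
    and "l \<in> {2, 3}"
    and "\<And>i. i \<le> r \<Longrightarrow> n i \<ge> 1"
    and "\<exists>\<phi> \<in> algebra_iso (terwilliger l X' E' x1)
                (direct_sum_algebra {0..r} (\<lambda>i. full_matrix_algebra (n i))).
           \<phi> (diag_idem {x1}) \<in> summand {0..r} (\<lambda>i. full_matrix_algebra (n i)) 0"
  shows "\<exists>\<psi> \<in> algebra_iso (terwilliger l X E x0)
                (direct_sum_algebra {0..r} (\<lambda>i. full_matrix_algebra ((n(0 := n 0 + 1)) i))).
           primitive_idempotent (terwilliger l X E x0) (diag_idem {x0}) \<and>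
           \<psi> (diag_idem {x0}) \<in> summand {0..r} (\<lambda>i. full_matrix_algebra ((n(0 := n 0 + 1)) i)) 0"
proof -
  interpret G: pendant_vertex X X' E E' x0 x1
    using assms by (intro pendant_vertex.intro)
  interpret vertex_extension X' x0 x1
    using G.finite_X' G.x0_notin G.x1_X' by unfold_locales
  obtain P where P: "{x1} \<in> P" "\<And>Y. Y \<in> P \<Longrightarrow> Y \<subseteq> X'"
    and T': "terwilliger l X' E' x1 =
      generated_algebra (matrix_algebra_on X') (insert (adj_matrix E') (diag_idem ` P))"
    and T: "terwilliger l X E x0 = generated_algebra (matrix_algebra_on X)
      (insert (adj_matrix E) (insert (diag_idem {x0}) (diag_idem ` P)))"
    using G.terwilliger_generators[OF \<open>l \<in> {2, 3}\<close>] by blast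
  define S where "S = unital_subalgebra (matrix_algebra_on X') hull
    (insert (adj_matrix E') (diag_idem ` P))"
  have A: "adj_matrix E \<in> carrier (matrix_algebra_on (insert x0 X'))"
    using simple_graph_edge_neq[OF G.simple] G.X_eq
    by (auto simp: matrix_algebra_on_carrier adj_matrix_def split: if_splits)
  then have A': "adj_matrix E' \<in> carrier (matrix_algebra_on X')"
    by (auto simp: matrix_algebra_on_carrier adj_matrix_def G.edge'_iff split: if_splits)
  have restr_A: "restr (adj_matrix E) = adj_matrix E'"
  proof (intro ext)
    fix x y
    show "restr (adj_matrix E) x y = adj_matrix E' x y"
      using A G.x0_notin
      by (auto simp: restr_def adj_matrix_def G.edge'_iff matrix_algebra_on_carrier split: if_splits)
  qed
  have S: "unital_subalgebra (matrix_algebra_on X') S"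
    unfolding S_def using A' P
    by (intro unital_subalgebra_hull unital_subalgebra_matrix_carrier) (auto intro!: diag_idem_carrier)
  have e_S: "diag_idem {x1} \<in> S" unfolding S_def using P(1) by (auto intro: hull_inc)
  have hull_S: "unital_subalgebra (matrix_algebra_on (insert x0 X')) hull
      (insert (adj_matrix E) (insert (diag_idem {x0}) (diag_idem ` P))) = extend S"
    unfolding S_def using P A' A restr_A
    by (rule hull_eq_extend) (simp_all add: adj_matrix_def G.edge_x0_iff)
  have T_eq: "terwilliger l X E x0 = (matrix_algebra_on (insert x0 X'))\<lparr>carrier := extend S\<rparr>"
    unfolding T generated_algebra_def unfolding G.X_eq hull_S ..
  obtain \<phi> where "\<phi> \<in> algebra_iso ((matrix_algebra_on X')\<lparr>carrier := S\<rparr>)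
      (direct_sum_algebra {0..r} (\<lambda>i. full_matrix_algebra (n i)))"
    "\<phi> (diag_idem {x1}) \<in> summand {0..r} (\<lambda>i. full_matrix_algebra (n i)) 0"
    using assms(11) by (auto simp: T' generated_algebra_def S_def)
  then interpret vertex_extension_algebra X' x0 x1 S r n \<phi>
    using S e_S by unfold_locales
  \<comment> \<open>The rank-one factors depend on the chosen \<open>\<phi>\<close>, hence the
    interpretation in two stages.\<close>
  obtain u v where "\<And>a b. a < n 0 \<Longrightarrow> b < n 0 \<Longrightarrow> \<phi> (diag_idem {x1}) 0 $$ (a, b) = u a * v b"
    "(\<Sum>k<n 0. v k * u k) = 1"
    using phi_e_rank_one by blast
  then interpret vertex_extension_iso X' x0 x1 S r n \<phi> u v
    by unfold_locales
  have "diag_idem {x0} \<in> extend S"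
    unfolding hull_S[symmetric] by (auto intro: hull_inc)
  \<comment> \<open>Primitivity is settled among matrices on \<open>X\<close>, without passing
    through the isomorphism.\<close>
  then have "primitive_idempotent (terwilliger l X E x0) (diag_idem {x0})"
    unfolding T_eq using finite_X'
    by (intro primitive_idempotent_vertex) (auto simp: extend_def)
  then show ?thesis
    using psi_iso psi_vertex_idem unfolding T_eq by blast
qed

end
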